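(* Let $q$ be a prime power and $n\ge 2$ an integer such that either $q>2$ or $n\ge 6$, and let $U\subsetneq\mathbb{F}_{q^n}$ be an $\mathbb{F}_q$-vector space of dimension $n-1$. Then: (1) if $q$ is even or $n$ is odd, $\omega(G_U)=q^{\lfloor n/2\rfloor}+n-2\lfloor n/2\rfloor$; (2) if $q$ is odd and $n$ is even, then $\omega(G_U)=q^{n/2}$ if $(q\bmod 4,\ n\bmod 4,\ s(U))\in\{(\pm1,0,-1),(-1,2,1),(1,2,-1)\}$, and $\omega(G_U)=q^{n/2-1}+2$ if $(q\bmod 4,\ n\bmod 4,\ s(U))\in\{(\pm1,0,1),(-1,2,-1),(1,2,1)\}$ (here $-1\bmod 4$ means residue $3$). Moreover, if $q=2$ and $2\le n\le 5$, then $\omega(G_U)=n+1$ for every $\mathbb{F}_2$-vector space $U\subsetneq\mathbb{F}_{2^n}$ of dimension $n-1$.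
   Context: $\mathrm{Tr}_n(a)=\sum_{i=0}^{n-1}a^{q^i}$ is the trace from $\mathbb{F}_{q^n}$ to $\mathbb{F}_q$, and $U_{q,n}=\{\alpha\in\mathbb{F}_{q^n}:\mathrm{Tr}_n(\alpha)=0\}$. For $q$ odd and $n$ even and $U$ an $\mathbb{F}_q$-subspace of dimension $n-1$, $s(U)=1$ if $U=a^2U_{q,n}$ for some $a\in\mathbb{F}_{q^n}^*$, and $s(U)=-1$ otherwise. For an $\mathbb{F}_q$-vector subspace $U\subsetneq\mathbb{F}_{q^n}$, $G_U$ is the undirected graph with vertex set $\mathbb{F}_{q^n}$ in which distinct $a,b$ are adjacent if and only if $ab\in U$, and $\omega(G_U)$ is its clique number. *)

theory Defs
  imports "HOL-Number_Theory.Prime_Powers" "HOL-Library.Ramsey" "HOL-Library.Cardinality"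
begin

text \<open>
  The field with \<open>q ^ n\<close> elements is a finite field type \<^typ>\<open>'a\<close> with \<open>CARD('a) = q ^ n\<close>; its
  subfield with \<open>q\<close> elements is the image of a finite field type \<^typ>\<open>'k\<close> with \<open>CARD('k) = q\<close>
  under a field embedding, so that subspaces and dimensions are those of the
  library for the induced scalar multiplication.
\<close>

definition field_embedding :: "('k::field \<Rightarrow> 'a::field) \<Rightarrow> bool" where
  "field_embedding \<iota> \<longleftrightarrow>
     \<iota> 1 = 1 \<and> (\<forall>x y. \<iota> (x + y) = \<iota> x + \<iota> y) \<and> (\<forall>x y. \<iota> (x * y) = \<iota> x * \<iota> y)"

definition ext_scale :: "('k::field \<Rightarrow> 'a::field) \<Rightarrow> 'k \<Rightarrow> 'a \<Rightarrow> 'a" where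
  "ext_scale \<iota> c x = \<iota> c * x"

lemma vector_space_ext_scale: "field_embedding \<iota> \<Longrightarrow> vector_space (ext_scale \<iota>)"
  by unfold_locales (simp_all add: field_embedding_def ext_scale_def algebra_simps)

definition field_trace :: "nat \<Rightarrow> nat \<Rightarrow> 'a::field \<Rightarrow> 'a" where
  "field_trace q n a = (\<Sum>i<n. a ^ (q ^ i))"

definition trace_zero :: "nat \<Rightarrow> nat \<Rightarrow> 'a::field set" where
  "trace_zero q n = {\<alpha>. field_trace q n \<alpha> = 0}"

definition sgn_subspace :: "nat \<Rightarrow> nat \<Rightarrow> 'a::field set \<Rightarrow> int" where
  "sgn_subspace q n U =
     (if \<exists>a. a \<noteq> 0 \<and> U = (\<lambda>u. a\<^sup>2 * u) ` trace_zero q n then 1 else - 1)"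

text \<open>Graphs are given by a vertex set and a set of two-element sets of vertices.\<close>

definition product_graph_edges :: "'a::field set \<Rightarrow> 'a set set" where
  "product_graph_edges U = {{a, b} | a b. a \<noteq> b \<and> a * b \<in> U}"

definition clique_number :: "'a set \<Rightarrow> 'a set set \<Rightarrow> nat" where
  "clique_number V E = Max {card C | C. C \<subseteq> V \<and> clique C E}"

abbreviation omega_G :: "'a::{field,finite} set \<Rightarrow> nat" where
  "omega_G U \<equiv> clique_number UNIV (product_graph_edges U)"

end

theory Submission
  imports Defs "HOL-Number_Theory.Residues" "HOL-Computational_Algebra.Polynomial"
begin

text \<open>
  Write \<open>U = {x. Tr (c * x) = 0}\<close>. A clique is a family of pairwise orthogonal vectors for the
  nondegenerate symmetric form \<open>Tr (c * x * y)\<close>. Its isotropic members span a totally isotropic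
  space of some dimension \<open>d\<close>, its \<open>k\<close> anisotropic members are independent, and
  \<open>2 * d + k \<le> n\<close>; so the size is at most \<open>q ^ d + k\<close>. Conversely a maximal totally isotropic
  space \<open>W\<close> has \<open>dim (W\<^sup>\<bottom> / W) \<le> 2\<close> (at most 1 in characteristic 2), and an orthogonal basis
  of the anisotropic quotient lifts to a clique together with \<open>W\<close>.

  For \<open>q\<close> odd and \<open>n = 2 * m\<close> it remains to decide whether a totally isotropic space of dimension
  \<open>m\<close> exists. Take \<open>y\<close> with \<open>y ^ (q ^ m) = - y\<close>. If \<open>y = c * x\<^sup>2\<close>, then \<open>x\<close> times the subfield
  of order \<open>q ^ m\<close> is such a space. Otherwise \<open>c\<close> and \<open>y\<close> lie in different square classes, and
  counting isotropic vectors shows that the forms of \<open>c\<close> and \<open>y\<close> cannot both have one.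
\<close>

section \<open>Vector spaces over finite fields\<close>

locale finite_vector_space = vector_space scale
  for scale :: "'k::{field,finite} \<Rightarrow> 'v::{ab_group_add,finite} \<Rightarrow> 'v" (infixr "*s" 75)
begin

text \<open>The set is the span of \<open>insert a S\<close> in the form that
  \<open>span_insert\<close> gives it. As \<open>a\<close> lies outside \<open>S\<close>, the
  decomposition \<open>c *s a + x\<close> is unique.\<close>

lemma card_span_insert:
  assumes "subspace S" "a \<notin> S"
  shows "card {x. \<exists>c. x - c *s a \<in> S} = CARD('k) * card S"
proof -
  have inj: "c = d" if "x \<in> S" "y \<in> S" "c *s a + x = d *s a + y" for c d x y
  proof (rule ccontr)
    assume "c \<noteq> d"
    have "(c - d) *s a = y - x"
      using that(3) by (simp add: scale_left_diff_distrib algebra_simps)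
    then have "a = inverse (c - d) *s (y - x)"
      using \<open>c \<noteq> d\<close> by (metis eq_iff_diff_eq_0 left_inverse scale_one scale_scale)
    then show False
      using assms that by (metis subspace_diff subspace_scale)
  qed
  have "inj_on (\<lambda>(c, x). c *s a + x) (UNIV \<times> S)"
    by (rule inj_onI) (use inj in \<open>auto, metis add_left_cancel\<close>)
  moreover have "(\<lambda>(c, x). c *s a + x) ` (UNIV \<times> S) = {x. \<exists>c. x - c *s a \<in> S}"
  proof safe
    fix x c assume "x - c *s a \<in> S"
    then show "x \<in> (\<lambda>(c, x). c *s a + x) ` (UNIV \<times> S)"
      by (intro image_eqI[of _ _ "(c, x - c *s a)"]) auto
  qed (metis add_diff_cancel_left')
  ultimately have "card {x. \<exists>c. x - c *s a \<in> S} = card ((UNIV :: 'k set) \<times> S)"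
    by (metis card_image)
  then show ?thesis
    by (simp add: card_cartesian_product)
qed

lemma card_subspace:
  assumes "subspace S"
  shows "card S = CARD('k) ^ dim S"
proof -
  have *: "independent b \<Longrightarrow> card (span b) = CARD('k) ^ card b" for b
  proof (induction b rule: finite_induct[OF finite])
    case (2 a b)
    then show ?case
      by (simp add: independent_insert span_insert card_span_insert)
  qed simp
  obtain b where "b \<subseteq> S" "independent b" "S \<subseteq> span b" "card b = dim S"
    using basis_exists by blast
  then show ?thesis
    using * assms by (metis span_subspace)
qed

text \<open>Subtracting a suitable multiple of \<open>s\<close> moves any point of \<open>S\<close>
  to level \<open>a\<close>, so \<open>S\<close> is a product of the field with each level
  set.\<close>

lemma card_level_set:
  fixes f :: "'v \<Rightarrow> 'k"
  assumes S: "subspace S"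
    and add: "\<And>x y. f (x + y) = f x + f y"
    and sc: "\<And>c x. f (c *s x) = c * f x"
    and s: "s \<in> S" "f s \<noteq> 0"
  shows "CARD('k) * card {x \<in> S. f x = a} = card S"
proof -
  have diff: "f (x - y) = f x - f y" for x y
    by (metis add add_diff_cancel diff_add_cancel)
  have "bij_betw (\<lambda>(c, x). c *s s + x) (UNIV \<times> {x \<in> S. f x = a}) S"
    by (rule bij_betw_byWitness
        [where f' = "\<lambda>y. ((f y - a) / f s, y - ((f y - a) / f s) *s s)"])
      (use assms diff in \<open>auto intro!: subspace_add subspace_scale subspace_diff\<close>)
  then have "card ((UNIV :: 'k set) \<times> {x \<in> S. f x = a}) = card S"
    by (simp add: bij_betw_same_card)
  then show ?thesis
    by (simp add: card_cartesian_product)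
qed

end

section \<open>Squares in a finite field\<close>

lemma card_squares_ge: "2 * card (range (\<lambda>x::'k::{field,finite}. x\<^sup>2)) \<ge> CARD('k) + 1"
proof -
  let ?R = "range (\<lambda>x::'k. x\<^sup>2)"
  have fib: "card {x::'k. x\<^sup>2 = y} \<le> 2" for y :: 'k
  proof (cases "\<exists>z. z\<^sup>2 = y")
    case True
    then obtain z where "z\<^sup>2 = y" by blast
    then have "{x. x\<^sup>2 = y} \<subseteq> {z, - z}"
      by (auto simp: power2_eq_iff)
    then have "card {x. x\<^sup>2 = y} \<le> card {z, - z}"
      by (intro card_mono) auto
    also have "\<dots> \<le> 2"
      by (simp add: card_insert_if)
    finally show ?thesis .
  qed simp
  \<comment> \<open>Fibres of squaring have at most two elements, but the fibre over 0 has only one;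
    splitting it off gives the extra 1 in the bound.\<close>
  have "CARD('k) = (\<Sum>y\<in>?R. card {x::'k. x\<^sup>2 = y})"
    using card_eq_sum[of "UNIV::'k set"] sum.image_gen[of "UNIV::'k set" "\<lambda>_. 1::nat" "\<lambda>x. x\<^sup>2"]
    by simp
  also have "\<dots> = card {x::'k. x\<^sup>2 = 0} + (\<Sum>y\<in>?R - {0}. card {x::'k. x\<^sup>2 = y})"
    by (rule sum.remove) (auto intro: image_eqI[of _ _ 0])
  also have "\<dots> \<le> 1 + (\<Sum>y\<in>?R - {0}. 2)"
    by (intro add_mono sum_mono fib) auto
  also have "\<dots> = 1 + 2 * (card ?R - 1)"
    by (subst sum_constant, subst card_Diff_singleton) (auto intro: image_eqI[of _ _ 0])
  finally have "CARD('k) \<le> 1 + 2 * (card ?R - 1)" .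
  moreover have "card ?R > 0"
    by (simp add: card_gt_0_iff)
  ultimately show ?thesis
    by linarith
qed

text \<open>Pigeonhole: the values of \<open>a * x\<^sup>2\<close> and of
  \<open>c - b * y\<^sup>2\<close> each fill more than half of the field, so some value is
  common.\<close>

lemma binary_form_universal:
  fixes a b c :: "'k::{field,finite}"
  assumes "a \<noteq> 0" "b \<noteq> 0"
  obtains x y where "a * x\<^sup>2 + b * y\<^sup>2 = c"
proof -
  let ?R = "range (\<lambda>x::'k. x\<^sup>2)"
  let ?A = "(\<lambda>z. a * z) ` ?R" and ?B = "(\<lambda>z. c - b * z) ` ?R"
  have cards: "card ?A = card ?R" "card ?B = card ?R"
    using assms by (intro card_image inj_onI; simp)+
  have "?A \<inter> ?B \<noteq> {}"
  proof
    assume "?A \<inter> ?B = {}"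
    then have "card (?A \<union> ?B) = 2 * card ?R"
      by (subst card_Un_disjoint) (use cards in auto)
    moreover have "card (?A \<union> ?B) \<le> CARD('k)"
      by (intro card_mono) auto
    ultimately show False
      using card_squares_ge[where 'k = 'k] by linarith
  qed
  then obtain x y where "a * x\<^sup>2 = c - b * y\<^sup>2"
    by auto
  then have "a * x\<^sup>2 + b * y\<^sup>2 = c"
    by simp
  then show ?thesis ..
qed

lemma square_surj_char_2:
  fixes y :: "'k::{field,finite}"
  assumes "(2::'k) = 0"
  obtains x where "x\<^sup>2 = y"
proof -
  have "x = z" if "x\<^sup>2 = z\<^sup>2" for x z :: 'k
  proof -
    have "- z = z"
      using assms by (metis add_eq_0_iff mult_2 mult_zero_left)
    with that show ?thesis
      by (auto simp: power2_eq_iff)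
  qed
  then have "inj (\<lambda>x::'k. x\<^sup>2)"
    by (rule injI)
  then have "surj (\<lambda>x::'k. x\<^sup>2)"
    by (simp add: finite_UNIV_inj_surj)
  then show ?thesis
    using that by (metis surjD)
qed

section \<open>Symmetric bilinear forms\<close>

locale finite_symmetric_form = finite_vector_space scale
  for scale :: "'k::{field,finite} \<Rightarrow> 'v::{ab_group_add,finite} \<Rightarrow> 'v" (infixr "*s" 75) +
  fixes B :: "'v \<Rightarrow> 'v \<Rightarrow> 'k"
  assumes sym: "B x y = B y x"
    and add_left: "B (x + y) z = B x z + B y z"
    and scale_left: "B (c *s x) z = c * B x z"
    and nondegenerate: "(\<And>y. B x y = 0) \<Longrightarrow> x = 0"
begin

lemma add_right: "B z (x + y) = B z x + B z y"
  by (metis sym add_left)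

lemma scale_right: "B z (c *s x) = c * B z x"
  by (metis sym scale_left)

lemma zero_left [simp]: "B 0 x = 0"
  using scale_left[of 0 0 x] by simp

lemma zero_right [simp]: "B x 0 = 0"
  by (metis sym zero_left)

lemma diff_left: "B (x - y) z = B x z - B y z"
  by (metis add_diff_cancel add_left diff_add_cancel)

lemma sum_left: "B (sum f A) z = (\<Sum>i\<in>A. B (f i) z)"
  by (induction A rule: infinite_finite_induct) (simp_all add: add_left)

definition perp :: "'v set \<Rightarrow> 'v set" where
  "perp W = {x. \<forall>w\<in>W. B x w = 0}"

definition orthogonal_family :: "'v set \<Rightarrow> bool" where
  "orthogonal_family C \<longleftrightarrow> (\<forall>x\<in>C. \<forall>y\<in>C. x \<noteq> y \<longrightarrow> B x y = 0)"

definition nonisotropic :: "'v set \<Rightarrow> bool" where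
  "nonisotropic C \<longleftrightarrow> (\<forall>x\<in>C. B x x \<noteq> 0)"

definition totally_isotropic :: "'v set \<Rightarrow> bool" where
  "totally_isotropic W \<longleftrightarrow> subspace W \<and> W \<subseteq> perp W"

lemma subspace_perp: "subspace (perp W)"
  by (simp add: subspace_def perp_def add_left scale_left)

lemma subspace_Int_perp: "subspace S \<Longrightarrow> subspace {x \<in> S. \<forall>c\<in>C. B x c = 0}"
  by (simp add: subspace_def add_left scale_left)

lemma perp_span: "perp (span C) = perp C"
proof
  show "perp C \<subseteq> perp (span C)"
  proof
    fix x assume "x \<in> perp C"
    then have "C \<subseteq> {y. B x y = 0}"
      by (auto simp: perp_def)
    moreover have "subspace {y. B x y = 0}"
      by (simp add: subspace_def add_right scale_right)
    ultimately have "span C \<subseteq> {y. B x y = 0}"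
      by (rule span_minimal)
    then show "x \<in> perp (span C)"
      by (auto simp: perp_def)
  qed
qed (auto simp: perp_def span_base)

lemma totally_isotropic_span:
  assumes "C \<subseteq> perp C"
  shows "totally_isotropic (span C)"
  by (simp add: totally_isotropic_def perp_span span_minimal subspace_perp assms)

text \<open>Double counting of the pairs \<open>(x, w)\<close> with \<open>w \<in> W\<close> and
  \<open>B x w = 0\<close>. A nonzero functional has its fair share of zeros, so an excess comes
  only from \<open>x \<in> perp W\<close> on one side and from \<open>w = 0\<close> on the
  other.\<close>

lemma card_perp:
  assumes W: "subspace W"
  shows "card W * card (perp W) = CARD('v)"
proof -
  let ?q = "CARD('k)" and ?N = "CARD('v)"
  have q: "?q \<ge> 2"
    using card_mono[of "UNIV :: 'k set" "{0, 1}"] by simp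
  have 1: "?q * card {w \<in> W. B x w = 0} = card W + (if x \<in> perp W then (?q - 1) * card W else 0)" for x
  proof (cases "x \<in> perp W")
    case True
    then have "{w \<in> W. B x w = 0} = W" by (auto simp: perp_def)
    then have "?q * card {w \<in> W. B x w = 0} = ((?q - 1) + 1) * card W"
      using q by simp
    with True show ?thesis
      by (simp add: algebra_simps)
  next
    case False
    then obtain w where "w \<in> W" "B x w \<noteq> 0" by (auto simp: perp_def)
    with False show ?thesis
      using card_level_set[OF W, of "B x" w 0] by (simp add: add_right scale_right)
  qed
  have 2: "?q * card {x. B x w = 0} = ?N + (if w = 0 then (?q - 1) * ?N else 0)" for w
  proof (cases "w = 0")
    case True
    have "?q * card {x. B x w = 0} = ((?q - 1) + 1) * ?N"
      using q True by simp
    with True show ?thesis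
      by (simp add: algebra_simps)
  next
    case False
    then obtain x where "B w x \<noteq> 0" using nondegenerate by blast
    with False show ?thesis
      using card_level_set[of UNIV "B w" x 0] by (simp add: add_right scale_right sym[of _ w])
  qed
  have "(\<Sum>x\<in>UNIV. card {w \<in> W. B x w = 0}) = (\<Sum>x\<in>UNIV. \<Sum>w\<in>W. of_bool (B x w = 0))"
    by (simp add: Int_def)
  also have "\<dots> = (\<Sum>w\<in>W. \<Sum>x\<in>UNIV. of_bool (B x w = 0))"
    by (rule sum.swap)
  also have "\<dots> = (\<Sum>w\<in>W. card {x. B x w = 0})"
    by simp
  finally have "(\<Sum>x\<in>UNIV. ?q * card {w \<in> W. B x w = 0}) = (\<Sum>w\<in>W. ?q * card {x. B x w = 0})"
    by (simp add: sum_distrib_left[symmetric])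
  then have "?N * card W + card (perp W) * ((?q - 1) * card W) = card W * ?N + (?q - 1) * ?N"
    unfolding 1 2 using subspace_0[OF W]
    by (simp add: sum.distrib sum.If_cases sum.delta)
  then have "(?q - 1) * (card W * card (perp W)) = (?q - 1) * ?N"
    by (simp add: algebra_simps)
  then show ?thesis
    using q by simp
qed

text \<open>Each \<open>c\<close> lies in the subspace cut out by the other members and
  \<open>B c c \<noteq> 0\<close>, so orthogonality to it divides the cardinality by exactly
  \<open>CARD('k)\<close>.\<close>

lemma card_Int_perp:
  assumes "subspace S" "C \<subseteq> S" "orthogonal_family C" "nonisotropic C"
  shows "card S = CARD('k) ^ card C * card {x \<in> S. \<forall>c\<in>C. B x c = 0}"
  using finite[of C] assms(2-)
proof (induction C rule: finite_induct)
  case (insert c C)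
  let ?S = "{x \<in> S. \<forall>c\<in>C. B x c = 0}"
  have "c \<in> ?S" "B c c \<noteq> 0"
    using insert by (auto simp: orthogonal_family_def nonisotropic_def)
  then have "CARD('k) * card {x \<in> ?S. B c x = 0} = card ?S"
    by (intro card_level_set[of ?S "B c" c 0] subspace_Int_perp assms(1)) (simp_all add: add_right scale_right)
  moreover have "{x \<in> ?S. B c x = 0} = {x \<in> S. \<forall>c\<in>insert c C. B x c = 0}"
    by (auto simp: sym[of _ c])
  ultimately show ?case
    using insert by (simp add: orthogonal_family_def nonisotropic_def algebra_simps)
qed simp

lemma card_orthogonal_family_le:
  assumes "orthogonal_family C"
  obtains W k where "totally_isotropic W" "card C \<le> card W + k"
    "card W * card W * CARD('k) ^ k \<le> CARD('v)"
proof -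
  define C0 where "C0 = {x \<in> C. B x x = 0}"
  define C1 where "C1 = {x \<in> C. B x x \<noteq> 0}"
  define W where "W = span C0"
  have ti: "totally_isotropic W"
    unfolding W_def using assms
    by (intro totally_isotropic_span) (auto simp: C0_def perp_def orthogonal_family_def)
  then have W: "subspace W" "W \<subseteq> perp W"
    by (auto simp: totally_isotropic_def)
  have C1: "C1 \<subseteq> perp W" "orthogonal_family C1" "nonisotropic C1"
    using assms unfolding W_def perp_span
    by (auto simp: C0_def C1_def perp_def orthogonal_family_def nonisotropic_def)
  let ?S = "{x \<in> perp W. \<forall>c\<in>C1. B x c = 0}"
  \<comment> \<open>Being orthogonal to itself and to \<open>C1\<close>, the space \<open>W\<close>
    survives all \<open>card C1\<close> cuts of \<open>perp W\<close>. This is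
    \<open>2 * d + k \<le> n\<close> in multiplicative form.\<close>
  have "W \<subseteq> ?S"
    using W(2) C1(1) by (auto simp: perp_def subset_iff) (metis sym)
  then have "card W \<le> card ?S"
    by (intro card_mono) auto
  then have "card W * (CARD('k) ^ card C1 * card W) \<le> card W * (CARD('k) ^ card C1 * card ?S)"
    by simp
  also have "\<dots> = CARD('v)"
    using card_Int_perp[OF subspace_perp C1] card_perp[OF W(1)] by simp
  finally have "card W * card W * CARD('k) ^ card C1 \<le> CARD('v)"
    by (simp add: algebra_simps)
  moreover have "card C \<le> card W + card C1"
  proof -
    have "C = C0 \<union> C1" by (auto simp: C0_def C1_def)
    then have "card C \<le> card C0 + card C1" by (metis card_Un_le)
    moreover have "card C0 \<le> card W"
      unfolding W_def by (intro card_mono span_superset) auto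
    ultimately show ?thesis by simp
  qed
  ultimately show ?thesis
    using that ti by blast
qed

section \<open>Maximal totally isotropic subspaces\<close>

definition max_isotropic :: "'v set \<Rightarrow> bool" where
  "max_isotropic W \<longleftrightarrow> totally_isotropic W \<and> (\<forall>x\<in>perp W. B x x = 0 \<longrightarrow> x \<in> W)"

text \<open>A totally isotropic space of largest cardinality works: an isotropic vector of
  \<open>perp W\<close> outside \<open>W\<close> could be adjoined to it.\<close>

lemma max_isotropic_exists:
  obtains W where "max_isotropic W"
proof -
  have "totally_isotropic {0}"
    by (simp add: totally_isotropic_def perp_def)
  moreover have "\<forall>W. totally_isotropic W \<longrightarrow> card W < Suc CARD('v)"
    using card_mono[of "UNIV :: 'v set"] by (simp add: less_Suc_eq_le)
  ultimately obtain W where W: "totally_isotropic W"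
      and max: "\<And>W'. totally_isotropic W' \<Longrightarrow> card W' \<le> card W"
    using ex_has_greatest_nat[of totally_isotropic "{0}" card "Suc CARD('v)"] by blast
  have "x \<in> W" if x: "x \<in> perp W" "B x x = 0" for x
  proof -
    have "insert x W \<subseteq> perp (insert x W)"
      using x W by (auto simp: totally_isotropic_def perp_def sym)
    then have "card (span (insert x W)) \<le> card W"
      by (intro max totally_isotropic_span)
    moreover have "W \<subseteq> span (insert x W)"
      using span_superset[of "insert x W"] by auto
    ultimately have "W = span (insert x W)"
      by (intro card_seteq) auto
    then show ?thesis
      by (metis insertI1 span_base)
  qed
  then show ?thesis
    using that W by (auto simp: max_isotropic_def)
qed

text \<open>The complement of \<open>C\<close> inside \<open>perp W\<close> is too large to fit into
  \<open>W\<close>, and by maximality every vector of \<open>perp W\<close> outside \<open>W\<close>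
  is anisotropic.\<close>

lemma max_isotropic_extend:
  assumes W: "max_isotropic W"
    and C: "C \<subseteq> perp W" "orthogonal_family C" "nonisotropic C"
    and less: "CARD('k) ^ card C * card W < card (perp W)"
  obtains v where "v \<in> perp W" "B v v \<noteq> 0" "\<And>c. c \<in> C \<Longrightarrow> B v c = 0" "v \<notin> C"
proof -
  let ?S = "{x \<in> perp W. \<forall>c\<in>C. B x c = 0}"
  have "card W < card ?S"
    using less card_Int_perp[OF subspace_perp C] by simp
  then have "\<not> ?S \<subseteq> W"
    using card_mono[of W ?S] by auto
  then obtain v where "v \<in> ?S" "v \<notin> W" by blast
  moreover from this have "B v v \<noteq> 0"
    using W by (auto simp: max_isotropic_def)
  ultimately show ?thesis
    using that by blast
qed

lemma max_isotropic_family: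
  assumes W: "max_isotropic W"
    and le: "CARD('k) ^ k * card W \<le> card (perp W)"
  obtains C where "C \<subseteq> perp W" "orthogonal_family C" "nonisotropic C" "card C = k"
proof -
  have "\<exists>C \<subseteq> perp W. orthogonal_family C \<and> nonisotropic C \<and> card C = k"
    using le
  proof (induction k)
    case 0
    show ?case
      by (intro exI[of _ "{}"]) (simp add: orthogonal_family_def nonisotropic_def)
  next
    case (Suc k)
    have "card W > 0"
      using W subspace_0 by (auto simp: max_isotropic_def totally_isotropic_def card_gt_0_iff)
    moreover have "CARD('k) > 1"
      using card_mono[of "UNIV :: 'k set" "{0, 1}"] by simp
    ultimately have "CARD('k) ^ k * card W < CARD('k) ^ Suc k * card W"
      by simp
    then have less: "CARD('k) ^ k * card W < card (perp W)"
      using Suc.prems by linarith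
    then obtain C where C: "C \<subseteq> perp W" "orthogonal_family C" "nonisotropic C" "card C = k"
      using Suc.IH by auto
    obtain v where "v \<in> perp W" "B v v \<noteq> 0" "\<And>c. c \<in> C \<Longrightarrow> B v c = 0" "v \<notin> C"
      using max_isotropic_extend[OF W C(1-3)] less C(4) by blast
    with C show ?case
      by (intro exI[of _ "insert v C"]) (auto simp: orthogonal_family_def nonisotropic_def sym)
  qed
  then show ?thesis
    using that by blast
qed

text \<open>Three orthogonal anisotropic vectors would span an isotropic one with coefficient 1 at
  \<open>w\<close>, since the binary form on \<open>u\<close> and \<open>v\<close> represents
  \<open>- B w w\<close>. Maximality puts it into \<open>W\<close>, yet its product with
  \<open>w\<close> is \<open>B w w \<noteq> 0\<close>.\<close>

lemma max_isotropic_codim: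
  assumes W: "max_isotropic W"
  shows "card (perp W) < CARD('k) ^ 3 * card W"
proof (rule ccontr)
  assume "\<not> ?thesis"
  then obtain C where C: "C \<subseteq> perp W" "orthogonal_family C" "nonisotropic C" "card C = 3"
    using max_isotropic_family[OF W, of 3] by (metis not_less)
  then obtain u v w where uvw: "C = {u, v, w}" "u \<noteq> v" "u \<noteq> w" "v \<noteq> w"
    by (auto simp: card_3_iff)
  with C have orth: "B u v = 0" "B v u = 0" "B u w = 0" "B w u = 0" "B v w = 0" "B w v = 0"
    and non: "B u u \<noteq> 0" "B v v \<noteq> 0" "B w w \<noteq> 0"
    by (auto simp: orthogonal_family_def nonisotropic_def)
  obtain s t where st: "B u u * s\<^sup>2 + B v v * t\<^sup>2 = - B w w"
    using binary_form_universal non by blast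
  define x where "x = s *s u + t *s v + w"
  have "B x x = B u u * s\<^sup>2 + B v v * t\<^sup>2 + B w w"
    using orth by (simp add: x_def add_left add_right scale_left scale_right
        power2_eq_square algebra_simps)
  then have "B x x = 0" using st by simp
  moreover have "x \<in> perp W"
    using C(1) uvw(1) subspace_perp[of W] by (simp add: x_def subspace_add subspace_scale)
  ultimately have "x \<in> W"
    using W by (auto simp: max_isotropic_def)
  then have "B w x = 0"
    using C(1) uvw(1) by (auto simp: perp_def)
  moreover have "B w x = B w w"
    using orth by (simp add: x_def add_right scale_right)
  ultimately show False
    using non by simp
qed

text \<open>Here two vectors suffice: every scalar is a square, so some \<open>s *s u + v\<close> is
  isotropic.\<close>

lemma max_isotropic_codim_char_2:
  assumes W: "max_isotropic W" and two: "(2::'k) = 0"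
  shows "card (perp W) < CARD('k) ^ 2 * card W"
proof (rule ccontr)
  assume "\<not> ?thesis"
  then obtain C where C: "C \<subseteq> perp W" "orthogonal_family C" "nonisotropic C" "card C = 2"
    using max_isotropic_family[OF W, of 2] by (metis not_less)
  then obtain u v where uv: "C = {u, v}" "u \<noteq> v"
    by (auto simp: card_2_iff)
  with C have orth: "B u v = 0" "B v u = 0" and non: "B u u \<noteq> 0" "B v v \<noteq> 0"
    by (auto simp: orthogonal_family_def nonisotropic_def)
  obtain s where s: "s\<^sup>2 = - B v v / B u u"
    using square_surj_char_2[OF two] .
  define x where "x = s *s u + v"
  have "B x x = B u u * s\<^sup>2 + B v v"
    using orth by (simp add: x_def add_left add_right scale_left scale_right
        power2_eq_square algebra_simps)
  then have "B x x = 0" using s non by simp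
  moreover have "x \<in> perp W"
    using C(1) uv(1) subspace_perp[of W] by (simp add: x_def subspace_add subspace_scale)
  ultimately have "x \<in> W"
    using W by (auto simp: max_isotropic_def)
  then have "B v x = 0"
    using C(1) uv(1) by (auto simp: perp_def)
  moreover have "B v x = B v v"
    using orth by (simp add: x_def add_right scale_right)
  ultimately show False
    using non by simp
qed

lemma max_isotropic_orthogonal_family:
  assumes W: "max_isotropic W"
    and le: "CARD('k) ^ k * card W \<le> card (perp W)"
  obtains C where "orthogonal_family C" "card C = card W + k"
proof -
  obtain C where C: "C \<subseteq> perp W" "orthogonal_family C" "nonisotropic C" "card C = k"
    using max_isotropic_family[OF assms] by blast
  have W': "W \<subseteq> perp W"
    using W by (auto simp: max_isotropic_def totally_isotropic_def)
  then have "W \<inter> C = {}"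
    using C(3) by (auto simp: nonisotropic_def perp_def)
  then have "card (W \<union> C) = card W + k"
    by (simp add: card_Un_disjoint C(4))
  moreover have "B y x = 0" if "x \<in> W" "y \<in> C" for x y
    using C(1) that by (auto simp: perp_def)
  then have "\<forall>x\<in>W. \<forall>y\<in>C. B x y = 0 \<and> B y x = 0"
    using sym by metis
  then have "orthogonal_family (W \<union> C)"
    using C(2) W' unfolding orthogonal_family_def perp_def by blast
  ultimately show ?thesis
    using that by blast
qed

text \<open>
  In a family of maximal size, if the complement of its span contained a pair with \<open>B s t = B v v\<close>,
  then \<open>v\<close> could be replaced by the three vectors \<open>v + s\<close>, \<open>v + t\<close>, \<open>v + s + t\<close>.
\<close>
lemma orthogonal_basis_char_2:
  assumes two: "(2::'k) = 0" and v0: "B v0 v0 \<noteq> 0"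
  obtains C where "orthogonal_family C" "nonisotropic C" "CARD('k) ^ card C = CARD('v)"
proof -
  let ?P = "\<lambda>C. orthogonal_family C \<and> nonisotropic C"
  have "?P {v0}"
    using v0 by (simp add: orthogonal_family_def nonisotropic_def)
  moreover have "\<forall>C. ?P C \<longrightarrow> card C < Suc CARD('v)"
    using card_mono[of "UNIV :: 'v set"] by (simp add: less_Suc_eq_le)
  ultimately obtain C where "?P C" and max: "\<And>C'. ?P C' \<Longrightarrow> card C' \<le> card C"
    using ex_has_greatest_nat[of ?P "{v0}" card "Suc CARD('v)"] by blast
  then have C: "orthogonal_family C" "nonisotropic C"
    by auto
  have "card C > 0"
    using max[of "{v0}"] \<open>?P {v0}\<close> by simp
  then obtain v where v: "v \<in> C"
    by fastforce
  \<comment> \<open>An anisotropic vector of \<open>perp C\<close> would enlarge the family, so the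
    form is alternating on \<open>perp C\<close>.\<close>
  have iso: "B s s = 0" if "s \<in> perp C" for s
  proof (rule ccontr)
    assume s: "B s s \<noteq> 0"
    then have "s \<notin> C"
      using that by (auto simp: perp_def)
    moreover have "?P (insert s C)"
      using that C s by (auto simp: orthogonal_family_def nonisotropic_def perp_def sym)
    ultimately show False
      using max[of "insert s C"] by simp
  qed
  have "s = 0" if s: "s \<in> perp C" for s
  proof (rule ccontr)
    assume "s \<noteq> 0"
    then obtain x where x: "B x s \<noteq> 0"
      using nondegenerate sym by metis
    \<comment> \<open>Removing the orthogonal projection of \<open>x\<close> to the span of
      \<open>C\<close> keeps the product with \<open>s\<close>, because \<open>s\<close> is
      orthogonal to \<open>C\<close>.\<close>
    define y where "y = x - (\<Sum>c\<in>C. (B x c / B c c) *s c)"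
    have y: "y \<in> perp C"
    proof -
      have "B y c = 0" if c: "c \<in> C" for c
      proof -
        have "(\<Sum>d\<in>C. B x d / B d d * B d c) = (\<Sum>d\<in>C. if d = c then B x c else 0)"
          using C c by (intro sum.cong) (auto simp: orthogonal_family_def nonisotropic_def)
        then show ?thesis
          using c by (simp add: y_def diff_left sum_left scale_left sum.delta)
      qed
      then show ?thesis by (simp add: perp_def)
    qed
    have "B c s = 0" if "c \<in> C" for c
      using s that sym by (simp add: perp_def)
    then have "B y s = B x s"
      by (simp add: y_def diff_left sum_left scale_left)
    \<comment> \<open>With this scaling \<open>B s t\<close> and \<open>B v v\<close> cancel in
      \<open>B (v + s) (v + t)\<close>, because their sum is twice \<open>B v v\<close>.\<close>
    define t where "t = (B v v / B x s) *s y"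
    have t: "t \<in> perp C"
      unfolding t_def using y subspace_perp subspace_scale by blast
    have st: "B t s = B v v"
      using x by (simp add: t_def scale_left \<open>B y s = B x s\<close>)
    have orth: "B v s = 0" "B v t = 0" "B s v = 0" "B t v = 0" "B s t = B v v"
        "B s s = 0" "B t t = 0"
      using s t v st iso sym by (auto simp: perp_def)
    have vv: "B v v + B v v = 0"
      using two by (metis mult_2 mult_zero_left)
    have Bv: "B v v \<noteq> 0"
      using C v by (auto simp: nonisotropic_def)
    define D where "D = {v + s, v + t, v + s + t}"
    have ne: "s \<noteq> 0" "t \<noteq> 0" "s \<noteq> t"
      using orth st Bv by auto
    then have "card D = 3"
      by (auto simp: D_def card_insert_if)
    have D: "orthogonal_family D" "nonisotropic D"
      using orth st Bv vv
      by (auto simp: D_def orthogonal_family_def nonisotropic_def add_left add_right)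
    have "B d c = 0" if "d \<in> D" "c \<in> C - {v}" for d c
      using that s t C v
      by (auto simp: D_def perp_def orthogonal_family_def add_left)
    then have DC: "\<forall>d\<in>D. \<forall>c\<in>C - {v}. B d c = 0 \<and> B c d = 0"
      using sym by metis
    then have "?P (D \<union> (C - {v}))"
      using D C unfolding orthogonal_family_def nonisotropic_def by blast
    moreover have "D \<inter> (C - {v}) = {}"
      using DC D(2) unfolding nonisotropic_def by blast
    ultimately have "card D + card (C - {v}) \<le> card C"
      using max by (metis card_Un_disjoint finite)
    then show False
      using v \<open>card D = 3\<close> \<open>card C > 0\<close> by (simp add: card_Diff_singleton)
  qed
  moreover have "0 \<in> perp C" by (simp add: perp_def)
  ultimately have "{x \<in> UNIV. \<forall>c\<in>C. B x c = 0} = {0}"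
    by (auto simp: perp_def)
  then have "CARD('k) ^ card C = CARD('v)"
    using card_Int_perp[of UNIV C] C by simp
  then show ?thesis
    using that C by blast
qed

text \<open>Such a \<open>W\<close> equals \<open>perp W\<close>. On a coset \<open>x + W\<close>
  outside \<open>W\<close> the value \<open>B (x + w) (x + w)\<close> is affine and not constant in
  \<open>w\<close>, so it has its fair share of zeros; on \<open>W\<close> it vanishes throughout,
  and this excess makes the inequality strict.\<close>

lemma card_isotropic_vectors_gt:
  assumes two: "(2::'k) \<noteq> 0" and ti: "totally_isotropic W" and W_card: "card W * card W = CARD('v)"
  shows "CARD('k) * card {x. B x x = 0} > CARD('v)"
proof -
  let ?q = "CARD('k)"
  have W: "subspace W" "W \<subseteq> perp W"
    using ti by (auto simp: totally_isotropic_def)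
  have q: "?q > 1"
    using card_mono[of "UNIV :: 'k set" "{0, 1}"] by simp
  have W0: "card W > 0"
    using subspace_0[OF W(1)] by (auto simp: card_gt_0_iff)
  have "card (perp W) = card W"
    using card_perp[OF W(1)] W_card W0 by (metis mult_left_cancel neq0_conv)
  then have W_perp: "W = perp W"
    using W(2) by (intro card_seteq) auto
  have fib: "?q * card {w \<in> W. B (x + w) (x + w) = 0} = card W + (if x \<in> W then (?q - 1) * card W else 0)" for x
  proof (cases "x \<in> W")
    case True
    then have "{w \<in> W. B (x + w) (x + w) = 0} = W"
      using W by (auto simp: perp_def subset_iff subspace_add)
    moreover have "?q * card W = ((?q - 1) + 1) * card W"
      using q by simp
    ultimately show ?thesis
      using True by (simp add: algebra_simps)
  next
    case False
    then obtain w where w: "w \<in> W" "B x w \<noteq> 0"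
      using W_perp by (auto simp: perp_def)
    have "B (x + w) (x + w) = 0 \<longleftrightarrow> B x w = - B x x / 2" if "w \<in> W" for w
    proof -
      have "B w w = 0" using W(2) that by (auto simp: perp_def)
      then have "B (x + w) (x + w) = B x x + 2 * B x w"
        by (simp add: add_left add_right sym[of w x])
      moreover have "B x x + 2 * B x w = 0 \<longleftrightarrow> 2 * B x w = - B x x"
        by (simp add: add_eq_0_iff)
      moreover have "2 * B x w = - B x x \<longleftrightarrow> B x w = - B x x / 2"
        using two by (metis nonzero_eq_divide_eq mult.commute)
      ultimately show ?thesis
        by metis
    qed
    then have "{w \<in> W. B (x + w) (x + w) = 0} = {w \<in> W. B x w = - B x x / 2}"
      by auto
    with False show ?thesis
      using card_level_set[OF W(1), of "B x" w] w by (simp add: add_right scale_right)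
  qed
  \<comment> \<open>Translation by \<open>w\<close> permutes the vectors, so after swapping the sums
    each \<open>w\<close> contributes the number of all isotropic vectors.\<close>
  have shift: "card {x. B (x + w) (x + w) = 0} = card {x. B x x = 0}" for w
    by (rule bij_betw_same_card[of "\<lambda>x. x + w"], rule bij_betw_byWitness[where f' = "\<lambda>x. x - w"]) auto
  have "(\<Sum>x\<in>UNIV. card {w \<in> W. B (x + w) (x + w) = 0})
      = (\<Sum>x\<in>UNIV. \<Sum>w\<in>W. of_bool (B (x + w) (x + w) = 0))"
    by (simp add: Int_def)
  also have "\<dots> = (\<Sum>w\<in>W. \<Sum>x\<in>UNIV. of_bool (B (x + w) (x + w) = 0))"
    by (rule sum.swap)
  also have "\<dots> = card W * card {x. B x x = 0}"
    by (simp add: shift)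
  finally have "(\<Sum>x\<in>UNIV. ?q * card {w \<in> W. B (x + w) (x + w) = 0}) = ?q * (card W * card {x. B x x = 0})"
    by (simp add: sum_distrib_left[symmetric])
  then have "CARD('v) * card W + card W * ((?q - 1) * card W) = ?q * (card W * card {x. B x x = 0})"
    unfolding fib by (simp add: sum.distrib sum.If_cases)
  then have "card W * (?q * card {x. B x x = 0}) = card W * (CARD('v) + (?q - 1) * card W)"
    by (simp add: algebra_simps)
  then have "?q * card {x. B x x = 0} = CARD('v) + (?q - 1) * card W"
    using W0 by auto
  then show ?thesis
    using q W0 by simp
qed

lemma orthogonal_family_dim_le:
  assumes n: "CARD('v) = CARD('k) ^ n" and "orthogonal_family C"
  obtains W d k where "totally_isotropic W" "card W = CARD('k) ^ d" "2 * d + k \<le> n"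
    "card C \<le> CARD('k) ^ d + k"
proof -
  obtain W k where W: "totally_isotropic W" "card C \<le> card W + k"
    "card W * card W * CARD('k) ^ k \<le> CARD('v)"
    using card_orthogonal_family_le assms(2) .
  have q: "CARD('k) > 1"
    using card_mono[of "UNIV :: 'k set" "{0, 1}"] by simp
  have d: "card W = CARD('k) ^ dim W"
    using W(1) by (simp add: card_subspace totally_isotropic_def)
  have "CARD('k) ^ (2 * dim W + k) \<le> CARD('k) ^ n"
    using W(3) unfolding d n by (simp add: power_add mult_2)
  then have "2 * dim W + k \<le> n"
    using q by (simp add: power_increasing_iff)
  then show ?thesis
    using that W d by metis
qed

text \<open>\<open>W\<close> is taken maximal, and \<open>C\<close> adds to it
  \<open>dim (perp W) - dim W = n - 2 * d\<close> anisotropic vectors. The upper bounds on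
  \<open>n\<close> are the codimension bounds.\<close>

lemma orthogonal_family_dim_exists:
  assumes n: "CARD('v) = CARD('k) ^ n"
  obtains W C d where "totally_isotropic W" "card W = CARD('k) ^ d" "2 * d \<le> n" "n \<le> 2 * d + 2"
    "(2::'k) = 0 \<Longrightarrow> n \<le> 2 * d + 1"
    "orthogonal_family C" "card C = CARD('k) ^ d + (n - 2 * d)"
proof -
  obtain W where W: "max_isotropic W"
    using max_isotropic_exists .
  then have ti: "totally_isotropic W" "subspace W" "W \<subseteq> perp W"
    by (auto simp: max_isotropic_def totally_isotropic_def)
  have q: "CARD('k) > 1"
    using card_mono[of "UNIV :: 'k set" "{0, 1}"] by simp
  define d where "d = dim W"
  define e where "e = dim (perp W)"
  have d: "card W = CARD('k) ^ d" and e: "card (perp W) = CARD('k) ^ e"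
    using ti by (simp_all add: card_subspace subspace_perp d_def e_def)
  have "d + e = n"
    using card_perp[OF ti(2)] q unfolding d e n by (simp flip: power_add)
  moreover have "d \<le> e"
    using card_mono[OF _ ti(3)] q unfolding d e by simp
  moreover have "e < 3 + d"
    using max_isotropic_codim[OF W] q unfolding d e by (simp flip: power_add)
  moreover have "e < 2 + d" if "(2::'k) = 0"
    using max_isotropic_codim_char_2[OF W that] q unfolding d e power_add[symmetric]
    by (simp only: power_strict_increasing_iff)
  moreover from calculation have "CARD('k) ^ (n - 2 * d) * card W \<le> card (perp W)"
    unfolding d e using q by (simp flip: power_add)
  then obtain C where "orthogonal_family C" "card C = card W + (n - 2 * d)"
    using max_isotropic_orthogonal_family[OF W] by blast
  ultimately show ?thesis
    using that[of W d C] ti d by fastforce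
qed

end

section \<open>Roots of unity and squares in finite fields\<close>

text \<open>Multiplication by \<open>x\<close> permutes the nonzero elements and so preserves their
  product.\<close>

lemma power_card_minus_1:
  fixes x :: "'a::{field,finite}"
  assumes "x \<noteq> 0"
  shows "x ^ (CARD('a) - 1) = 1"
proof -
  have "(\<Prod>y\<in>UNIV - {0}. x * y) = (\<Prod>y\<in>UNIV - {0::'a}. y)"
    by (rule prod.reindex_bij_witness[of _ "\<lambda>y. y / x" "\<lambda>y. x * y"]) (use assms in auto)
  then have "x ^ card (UNIV - {0::'a}) * \<Prod>(UNIV - {0}) = \<Prod>(UNIV - {0})"
    by (simp add: prod.distrib)
  moreover have "\<Prod>(UNIV - {0::'a}) \<noteq> 0"
    by simp
  ultimately show ?thesis
    by (simp add: card_Diff_singleton)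
qed

lemma card_roots_of_unity_le:
  assumes "d > 0"
  shows "card {x::'a::{field,finite}. x ^ d = 1} \<le> d"
proof -
  let ?p = "monom 1 d - 1 :: 'a poly"
  have "poly ?p 0 \<noteq> 0"
    using assms by (simp add: poly_monom power_0_left)
  then have "?p \<noteq> 0"
    by force
  then have "card {x. poly ?p x = 0} \<le> degree ?p"
    by (rule card_poly_roots_bound)
  also have "\<dots> \<le> d"
    by (intro degree_diff_le) (simp_all add: degree_monom_le)
  finally show ?thesis
    by (simp add: poly_monom)
qed

text \<open>With \<open>d * e = CARD('a) - 1\<close>, every nonzero element is a root of
  \<open>X ^ (d * e) - 1\<close>. Its cofactor after splitting off \<open>X ^ d - 1\<close> has at
  most \<open>d * (e - 1)\<close> roots, which leaves at least \<open>d\<close>.\<close>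

lemma card_roots_of_unity:
  assumes "d dvd CARD('a::{field,finite}) - 1"
  shows "card {x::'a. x ^ d = 1} = d"
proof (rule antisym)
  have N: "CARD('a) - 1 > 0"
    using card_mono[of "UNIV :: 'a set" "{0, 1}"] by simp
  from assms obtain e where e: "CARD('a) - 1 = d * e" ..
  with N have d: "d > 0" and e0: "e > 0"
    by (auto intro: Nat.gr0I)
  show "card {x::'a. x ^ d = 1} \<le> d"
    using card_roots_of_unity_le[OF d] .
  let ?p = "\<Sum>i<e. monom 1 (d * i) :: 'a poly"
  have poly: "poly ?p x = (\<Sum>i<e. (x ^ d) ^ i)" for x
    by (simp add: poly_sum poly_monom power_mult)
  have "poly ?p 0 = (\<Sum>i<e. if i = 0 then 1 else 0)"
    unfolding poly using d by (intro sum.cong) (auto simp: power_0_left)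
  then have "poly ?p 0 \<noteq> 0"
    using e0 by simp
  then have "?p \<noteq> 0"
    by fastforce
  then have "card {x. poly ?p x = 0} \<le> degree ?p"
    by (rule card_poly_roots_bound)
  also have "\<dots> \<le> d * (e - 1)"
  proof (rule degree_sum_le)
    fix i assume "i \<in> {..<e}"
    then have "d * i \<le> d * (e - 1)"
      by (intro mult_le_mono2) simp
    then show "degree (monom 1 (d * i) :: 'a poly) \<le> d * (e - 1)"
      using degree_monom_le order.trans by blast
  qed simp
  finally have roots: "card {x. poly ?p x = 0} \<le> d * (e - 1)" .
  have "x ^ d = 1 \<or> poly ?p x = 0" if "x \<noteq> 0" for x :: 'a
  proof -
    have "(x ^ d - 1) * poly ?p x = (x ^ d) ^ e - 1"
      unfolding poly by (rule power_diff_1_eq[symmetric])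
    also have "\<dots> = 0"
      using power_card_minus_1[OF that] by (simp only: e power_mult diff_self)
    finally show ?thesis by simp
  qed
  then have "UNIV - {0::'a} \<subseteq> {x. x ^ d = 1} \<union> {x. poly ?p x = 0}"
    by auto
  then have "card (UNIV - {0::'a}) \<le> card ({x::'a. x ^ d = 1} \<union> {x. poly ?p x = 0})"
    by (intro card_mono) auto
  also have "\<dots> \<le> card {x::'a. x ^ d = 1} + d * (e - 1)"
    by (rule order.trans[OF card_Un_le]) (use roots in simp)
  finally have "d * e \<le> card {x::'a. x ^ d = 1} + d * (e - 1)"
    using e by (simp add: card_Diff_singleton)
  moreover have "d * e = d * (e - 1) + d"
    using e0 by (cases e) auto
  ultimately show "d \<le> card {x::'a. x ^ d = 1}"
    by linarith
qed

text \<open>The nonzero squares lie among the \<open>h\<close> solutions of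
  \<open>z ^ h = 1\<close>, where \<open>2 * h = CARD('a) - 1\<close>, and there are at least
  \<open>h\<close> of them.\<close>

lemma Euler_criterion_finite_field:
  fixes z :: "'a::{field,finite}"
  assumes "odd CARD('a)" "z \<noteq> 0"
  shows "(\<exists>x. z = x\<^sup>2) \<longleftrightarrow> z ^ ((CARD('a) - 1) div 2) = 1"
proof -
  let ?R = "range (\<lambda>x::'a. x\<^sup>2)"
  obtain h where card: "CARD('a) = 2 * h + 1"
    using assms(1) by (rule oddE)
  have "?R - {0} \<subseteq> {z. z ^ h = 1}"
  proof safe
    fix x :: 'a assume "x\<^sup>2 \<noteq> 0"
    then have "x ^ (2 * h) = 1"
      using power_card_minus_1[of x] by (simp add: card)
    then show "(x\<^sup>2) ^ h = 1"
      by (simp only: power_mult)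
  qed
  moreover have "card {z::'a. z ^ h = 1} = h"
    by (rule card_roots_of_unity) (simp add: card)
  moreover have "card (?R - {0}) = card ?R - 1"
    by (rule card_Diff_singleton) (auto intro: image_eqI[of _ _ 0])
  moreover have "h \<le> card ?R - 1"
    using card_squares_ge[where 'k = 'a] card by linarith
  ultimately have "?R - {0} = {z. z ^ h = 1}"
    by (intro card_seteq) auto
  then have "z \<in> ?R - {0} \<longleftrightarrow> z ^ h = 1"
    by simp
  then show ?thesis
    using assms(2) by (simp add: image_iff card)
qed

lemma power_half_card_cases:
  fixes z :: "'a::{field,finite}"
  assumes "odd CARD('a)" "z \<noteq> 0"
  shows "z ^ ((CARD('a) - 1) div 2) = 1 \<or> z ^ ((CARD('a) - 1) div 2) = - 1"
proof -
  obtain h where card: "CARD('a) = 2 * h + 1"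
    using assms(1) by (rule oddE)
  have "(z ^ h)\<^sup>2 = z ^ (CARD('a) - 1)"
    by (simp add: card power_mult[symmetric] mult.commute)
  then show ?thesis
    using power_card_minus_1[OF assms(2)] by (simp add: card power2_eq_1_iff)
qed

section \<open>The characteristic of a finite field\<close>

lemma CHAR_finite_field: "prime CHAR('a::{field,finite})"
  using finite_imp_CHAR_pos[where 'a = 'a] prime_CHAR_semidom[where 'a = 'a] by simp

lemma card_eq_CHAR_power:
  assumes "primepow CARD('a::{field,finite})"
  obtains e where "e > 0" "CARD('a) = CHAR('a) ^ e"
proof -
  obtain p e where pe: "prime p" "e > 0" "CARD('a) = p ^ e"
    using assms by (auto simp: primepow_def)
  have "CHAR('a) dvd p"
    using CHAR_dvd_CARD[where 'a = 'a] CHAR_finite_field[where 'a = 'a] pe(3)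
    by (metis prime_dvd_power)
  then have "CHAR('a) = p"
    using CHAR_finite_field[where 'a = 'a] pe(1) by (simp add: primes_dvd_imp_eq)
  then show ?thesis
    using that pe by blast
qed

lemma two_eq_0_iff_even_card:
  assumes "primepow CARD('a::{field,finite})"
  shows "(2::'a) = 0 \<longleftrightarrow> even CARD('a)"
proof -
  have "(2::'a) = 0 \<longleftrightarrow> of_nat 2 = (0::'a)"
    by simp
  also have "\<dots> \<longleftrightarrow> CHAR('a) dvd 2"
    by (rule of_nat_eq_0_iff_char_dvd)
  also have "\<dots> \<longleftrightarrow> CHAR('a) = 2"
    using primes_dvd_imp_eq[OF CHAR_finite_field[where 'a = 'a] two_is_prime_nat] by auto
  also have "\<dots> \<longleftrightarrow> even CHAR('a)"
    using CHAR_finite_field[where 'a = 'a] 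
    by (metis dvd_refl primes_dvd_imp_eq two_is_prime_nat)
  also have "\<dots> \<longleftrightarrow> even CARD('a)"
    using card_eq_CHAR_power[OF assms] by (metis even_power)
  finally show ?thesis .
qed

section \<open>Trace forms\<close>

locale finite_field_extension =
  fixes \<iota> :: "'k::{field,finite} \<Rightarrow> 'a::{field,finite}" and q n :: nat
  assumes embedding: "field_embedding \<iota>"
    and primepow_q: "primepow q"
    and card_base [simp]: "CARD('k) = q"
    and card_ext: "CARD('a) = q ^ n"
    and n_pos: "n > 0"
begin

sublocale finite_vector_space "ext_scale \<iota>"
  by (simp add: finite_vector_space_def vector_space_ext_scale embedding)

section \<open>The embedded base field and the Frobenius map\<close>

lemma q_gt_1: "q > 1"
  using primepow_q primepow_gt_Suc_0 by auto

lemma emb_add: "\<iota> (x + y) = \<iota> x + \<iota> y"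
  and emb_mult: "\<iota> (x * y) = \<iota> x * \<iota> y"
  and emb_1 [simp]: "\<iota> 1 = 1"
  using embedding by (simp_all add: field_embedding_def)

lemma emb_0 [simp]: "\<iota> 0 = 0"
  using emb_add[of 0 0] by (metis add_cancel_right_right)

lemma emb_power: "\<iota> (x ^ i) = \<iota> x ^ i"
  by (induction i) (simp_all add: emb_mult)

lemma emb_diff: "\<iota> (x - y) = \<iota> x - \<iota> y"
  by (metis add_diff_cancel diff_add_cancel emb_add)

lemma emb_eq_0_iff [simp]: "\<iota> x = 0 \<longleftrightarrow> x = 0"
  by (metis emb_0 emb_1 emb_mult mult_zero_left right_inverse zero_neq_one)

lemma inj_emb: "inj \<iota>"
  by (rule injI) (metis emb_diff emb_eq_0_iff right_minus_eq)

lemma frobenius_add: "(x + y :: 'a) ^ (q ^ i) = x ^ (q ^ i) + y ^ (q ^ i)"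
proof -
  obtain p e where pe: "prime p" "e > 0" "q = p ^ e"
    using primepow_q by (auto simp: primepow_def)
  have "CHAR('a) dvd p ^ (e * n)"
    using CHAR_dvd_CARD[where 'a = 'a] by (simp add: card_ext pe(3) power_mult)
  then have "CHAR('a) = p"
    using CHAR_finite_field[where 'a = 'a] pe(1) prime_dvd_power primes_dvd_imp_eq by blast
  then have "q ^ i = CHAR('a) ^ (e * i)"
    by (simp add: pe(3) power_mult)
  then show ?thesis
    using freshmans_dream' CHAR_finite_field by blast
qed

lemma frobenius_sum: "(sum f A :: 'a) ^ (q ^ i) = (\<Sum>j\<in>A. f j ^ (q ^ i))"
  using q_gt_1
  by (induction A rule: infinite_finite_induct) (simp_all add: frobenius_add power_0_left)

lemma power_card_ext: "(x::'a) ^ (q ^ n) = x"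
proof (cases "x = 0")
  case False
  have "q ^ n = Suc (CARD('a) - 1)"
    using q_gt_1 by (simp add: card_ext)
  then have "x ^ (q ^ n) = x * x ^ (CARD('a) - 1)"
    by (simp only: power_Suc)
  then show ?thesis
    using power_card_minus_1[OF False] by simp
qed (use q_gt_1 in \<open>simp add: power_0_left\<close>)

lemma emb_power_q: "\<iota> c ^ (q ^ i) = \<iota> c"
proof -
  have "c ^ q = c"
  proof (cases "c = 0")
    case False
    have "c ^ Suc (q - 1) = c"
      using power_card_minus_1[OF False] by simp
    then show ?thesis
      using q_gt_1 by simp
  qed (use q_gt_1 in simp)
  then have "\<iota> c ^ q = \<iota> c"
    by (metis emb_power)
  then show ?thesis
    by (induction i) (simp_all add: power_mult)
qed

text \<open>The nonzero fixed points are the solutions of \<open>x ^ (q ^ m - 1) = 1\<close>, and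
  \<open>q ^ m - 1\<close> divides \<open>q ^ n - 1\<close> because \<open>m\<close> divides
  \<open>n\<close>.\<close>

lemma card_fixed_points:
  assumes "m dvd n" "m > 0"
  shows "card {x::'a. x ^ (q ^ m) = x} = q ^ m"
proof -
  have qm: "q ^ m > 1"
    using q_gt_1 assms(2) by (simp only: one_less_power)
  obtain l where l: "n = m * l"
    using assms(1) ..
  have "[(q ^ m) ^ l = 1 ^ l] (mod (q ^ m - 1))"
    using qm by (intro cong_pow) (simp add: cong_altdef_nat)
  then have "q ^ m - 1 dvd CARD('a) - 1"
    using q_gt_1 by (simp add: card_ext l power_mult cong_altdef_nat)
  then have "card {x::'a. x ^ (q ^ m - 1) = 1} = q ^ m - 1"
    by (rule card_roots_of_unity)
  moreover have "{x::'a. x ^ (q ^ m) = x} = insert 0 {x. x ^ (q ^ m - 1) = 1}"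
  proof -
    have "x ^ (q ^ m) = x * x ^ (q ^ m - 1)" for x :: 'a
      using qm by (metis Suc_pred' less_trans power_Suc zero_less_one)
    then show ?thesis
      by auto
  qed
  ultimately show ?thesis
    using qm by (simp add: power_0_left)
qed

lemma range_emb: "range \<iota> = {x. x ^ q = x}"
proof (rule card_seteq)
  show "range \<iota> \<subseteq> {x. x ^ q = x}"
    using emb_power_q[of _ 1] by auto
  show "card {x::'a. x ^ q = x} \<le> card (range \<iota>)"
    using card_fixed_points[of 1] by (simp add: card_image inj_emb)
qed auto

lemma trace_in_range: "field_trace q n (x::'a) \<in> range \<iota>"
proof -
  have "field_trace q n x ^ q = (\<Sum>i<n. x ^ (q ^ Suc i))"
    using frobenius_sum[of "\<lambda>i. x ^ (q ^ i)" "{..<n}" 1]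
    by (simp add: field_trace_def power_mult[symmetric] mult.commute)
  also have "\<dots> = field_trace q n x"
  proof -
    \<comment> \<open>Raising to the power \<open>q\<close> shifts the summands. Adding
      \<open>x\<close> gives the sum of \<open>n + 1\<close> terms, whose last term
      \<open>x ^ (q ^ n)\<close> is again \<open>x\<close>.\<close>
    have "x + (\<Sum>i<n. x ^ (q ^ Suc i)) = (\<Sum>i<Suc n. x ^ (q ^ i))"
      by (subst sum.lessThan_Suc_shift) simp
    also have "\<dots> = field_trace q n x + x"
      by (simp add: field_trace_def power_card_ext)
    finally show ?thesis
      by (simp add: add.commute)
  qed
  finally show ?thesis
    by (simp add: range_emb)
qed

text \<open>Pulling the trace back along \<iota> makes it a functional with values in the scalars,
  as a bilinear form requires.\<close>

definition tr :: "'a \<Rightarrow> 'k" where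
  "tr x = inv_into UNIV \<iota> (field_trace q n x)"

lemma emb_tr: "\<iota> (tr x) = field_trace q n x"
  unfolding tr_def using trace_in_range by (rule f_inv_into_f)

lemma tr_eq_0_iff: "tr x = 0 \<longleftrightarrow> field_trace q n x = 0"
  by (simp flip: emb_tr)

lemma tr_add: "tr (x + y) = tr x + tr y"
proof -
  have "\<iota> (tr (x + y)) = \<iota> (tr x + tr y)"
    by (simp add: emb_add emb_tr field_trace_def frobenius_add sum.distrib)
  then show ?thesis
    using inj_emb by (simp add: inj_eq)
qed

lemma tr_scale: "tr (\<iota> c * x) = c * tr x"
proof -
  have "\<iota> (tr (\<iota> c * x)) = \<iota> (c * tr x)"
    by (simp add: emb_mult emb_tr field_trace_def power_mult_distrib emb_power_q sum_distrib_left)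
  then show ?thesis
    using inj_emb by (simp add: inj_eq)
qed

text \<open>The trace polynomial has degree at most \<open>q ^ (n - 1)\<close>, less than the number
  of field elements, and its term for \<open>i = 0\<close> shows that it is nonzero.\<close>

lemma tr_nonzero: "\<exists>x. tr x \<noteq> 0"
proof (rule ccontr)
  assume "\<nexists>x. tr x \<noteq> 0"
  then have zero: "field_trace q n x = 0" for x :: 'a
    by (simp add: tr_eq_0_iff)
  let ?p = "\<Sum>i<n. monom 1 (q ^ i) :: 'a poly"
  have "coeff ?p 1 = (\<Sum>i<n. if i = 0 then 1 else 0)"
    unfolding coeff_sum using q_gt_1 by (intro sum.cong) auto
  then have "coeff ?p 1 \<noteq> 0"
    using n_pos by simp
  then have "?p \<noteq> 0"
    by fastforce
  then have "card {x. poly ?p x = 0} \<le> degree ?p"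
    by (rule card_poly_roots_bound)
  also have "\<dots> \<le> q ^ (n - 1)"
  proof (rule degree_sum_le)
    fix i assume "i \<in> {..<n}"
    then have "q ^ i \<le> q ^ (n - 1)"
      using q_gt_1 by (intro power_increasing) auto
    then show "degree (monom 1 (q ^ i) :: 'a poly) \<le> q ^ (n - 1)"
      using degree_monom_le order.trans by blast
  qed simp
  also have "\<dots> < q ^ n"
    using q_gt_1 n_pos by simp
  finally show False
    using zero by (simp add: poly_sum poly_monom field_trace_def card_ext)
qed

text \<open>For nonzero \<open>x\<close> the product \<open>c * (x * y)\<close> takes every value,
  in particular one of nonzero trace.\<close>

lemma finite_symmetric_form_tr:
  assumes "c \<noteq> 0"
  shows "finite_symmetric_form (ext_scale \<iota>) (\<lambda>x y. tr (c * (x * y)))"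
proof
  show "x = 0" if "\<And>y. tr (c * (x * y)) = 0" for x
  proof (rule ccontr)
    assume "x \<noteq> 0"
    obtain z where "tr z \<noteq> 0"
      using tr_nonzero by blast
    moreover have "c * (x * (z / (c * x))) = z"
      using assms \<open>x \<noteq> 0\<close> by simp
    ultimately show False
      using that by metis
  qed
  show "tr (c * (ext_scale \<iota> a x * z)) = a * tr (c * (x * z))" for a x z
    by (simp add: ext_scale_def mult.left_commute[of c] mult.assoc tr_scale)
qed (simp_all add: mult.commute distrib_left distrib_right tr_add)

section \<open>Hyperplanes as kernels of scaled traces\<close>

abbreviation hyperplane :: "'a \<Rightarrow> 'a set" where
  "hyperplane c \<equiv> {x. tr (c * x) = 0}"

lemma card_hyperplane:
  assumes "c \<noteq> 0"
  shows "q * card (hyperplane c) = q ^ n"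
proof -
  obtain z where "tr z \<noteq> 0"
    using tr_nonzero by blast
  then have "tr (c * (z / c)) \<noteq> 0"
    using assms by simp
  then show ?thesis
    using card_level_set[of UNIV "\<lambda>x. tr (c * x)" "z / c" 0]
    by (simp add: distrib_left tr_add ext_scale_def mult.left_commute[of c] tr_scale card_ext)
qed

text \<open>The set is the orthogonal complement of \<open>U\<close> for the trace form with
  coefficient 1.\<close>

lemma card_annihilator:
  assumes "subspace U" "card U = q ^ (n - 1)"
  shows "card {c. \<forall>u\<in>U. tr (c * u) = 0} = q"
proof -
  interpret F: finite_symmetric_form "ext_scale \<iota>" "\<lambda>x y. tr (1 * (x * y))"
    by (rule finite_symmetric_form_tr) simp
  have "q ^ (n - 1) * card (F.perp U) = q ^ n"
    using F.card_perp[OF assms(1)] by (simp add: assms(2) card_ext)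
  also have "\<dots> = q ^ (n - 1) * q"
    using n_pos by (cases n) auto
  finally have "card (F.perp U) = q"
    using q_gt_1 by simp
  then show ?thesis
    unfolding F.perp_def by simp
qed

lemma subspace_eq_hyperplane:
  assumes "subspace U" "card U = q ^ (n - 1)"
  obtains c where "c \<noteq> 0" "U = hyperplane c"
proof -
  let ?A = "{c. \<forall>u\<in>U. tr (c * u) = 0}"
  have "\<not> ?A \<subseteq> {0}"
  proof
    assume "?A \<subseteq> {0}"
    then have "card ?A \<le> 1"
      using card_mono[of "{0}" ?A] by simp
    then show False
      using card_annihilator[OF assms] q_gt_1 by simp
  qed
  then obtain c where c: "c \<noteq> 0" "\<forall>u\<in>U. tr (c * u) = 0"
    by blast
  have "q * card (hyperplane c) = q * card U"
    using card_hyperplane[OF c(1)] n_pos by (cases n) (auto simp: assms(2))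
  then have "U = hyperplane c"
    using q_gt_1 c(2) by (intro card_seteq) auto
  then show ?thesis
    using that c by blast
qed

text \<open>The annihilator of the hyperplane has only \<open>q\<close> elements, so it consists of
  the base field multiples of \<open>c\<close>; it also contains \<open>d\<close>.\<close>

lemma hyperplane_eqD:
  assumes "c \<noteq> 0" "d \<noteq> 0" "hyperplane c = hyperplane d"
  obtains a where "d = \<iota> a * c"
proof -
  let ?A = "{b. \<forall>u\<in>hyperplane c. tr (b * u) = 0}"
  have "subspace (hyperplane c)"
    \<comment> \<open>This instance of \<open>tr_scale\<close> supplies
      \<open>tr 0 = 0\<close>.\<close>
    unfolding subspace_def using tr_scale[of _ 0, of 0]
    by (auto simp: distrib_left tr_add ext_scale_def mult.left_commute[of c] tr_scale)
  moreover have "q * card (hyperplane c) = q * q ^ (n - 1)"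
    using card_hyperplane[OF assms(1)] n_pos by (cases n) auto
  then have "card (hyperplane c) = q ^ (n - 1)"
    using q_gt_1 by simp
  ultimately have "card ?A = q"
    by (rule card_annihilator)
  moreover have "card ((\<lambda>a. \<iota> a * c) ` UNIV) = q"
    using assms(1) inj_emb by (subst card_image) (auto intro!: injI simp: inj_eq)
  moreover have "(\<lambda>a. \<iota> a * c) ` UNIV \<subseteq> ?A"
    by (auto simp: mult.assoc tr_scale)
  ultimately have "(\<lambda>a. \<iota> a * c) ` UNIV = ?A"
    by (intro card_seteq) auto
  moreover have "d \<in> ?A"
    using assms(3) by blast
  ultimately show ?thesis
    using that by blast
qed

lemma hyperplane_scale:
  assumes "a \<noteq> 0"
  shows "(\<lambda>u. a * u) ` trace_zero q n = hyperplane (inverse a)"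
proof
  show "hyperplane (inverse a) \<subseteq> (\<lambda>u. a * u) ` trace_zero q n"
  proof
    fix x assume "x \<in> hyperplane (inverse a)"
    then show "x \<in> (\<lambda>u. a * u) ` trace_zero q n"
      using assms by (intro image_eqI[of _ _ "inverse a * x"]) (simp_all add: trace_zero_def tr_eq_0_iff)
  qed
qed (use assms in \<open>auto simp: trace_zero_def tr_eq_0_iff simp flip: mult.assoc\<close>)

end

section \<open>Cliques\<close>

text \<open>One more isotropic dimension costs two anisotropic vectors, and the factor
  \<open>q\<close> makes up for them. For \<open>q = 2\<close> and \<open>d = 0\<close> it does not,
  since \<open>1 + 2 > 2\<close>.\<close>

lemma power_plus_double_le:
  assumes "q \<ge> 3 \<or> q = 2 \<and> d > 0"
  shows "q ^ d + 2 * j \<le> (q::nat) ^ (d + j)"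
proof (induction j)
  case (Suc j)
  have "q ^ (d + j) + 2 \<le> q * q ^ (d + j)"
  proof -
    consider "q \<ge> 3" | "q = 2" "d > 0" using assms by blast
    then show ?thesis
    proof cases
      case 1
      then have "3 * q ^ (d + j) \<le> q * q ^ (d + j)" by (rule mult_le_mono1)
      moreover have "q ^ (d + j) \<ge> 1" using 1 by simp
      ultimately show ?thesis by linarith
    next
      case 2
      then have "(2::nat) ^ 1 \<le> 2 ^ (d + j)" by (intro power_increasing) auto
      then show ?thesis using 2 by simp
    qed
  qed
  with Suc show ?case by simp
qed simp

text \<open>This covers the exceptional start \<open>q = 2\<close>, \<open>d = 0\<close>. The
  inequality fails for \<open>m = 1\<close> and \<open>m = 2\<close>, whence the condition
  \<open>n \<ge> 6\<close>.\<close>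

lemma double_less_power_2:
  assumes "m \<ge> 3"
  shows "1 + 2 * m \<le> (2::nat) ^ m"
  using assms
proof (induction m rule: dec_induct)
  case (step m)
  then show ?case by simp
qed simp

lemma clique_size_bound:
  fixes q :: nat
  assumes "q > 2 \<or> q = 2 \<and> n \<ge> 6" "2 * d + k \<le> n"
  shows "q ^ d + k \<le> q ^ (n div 2) + (n - 2 * (n div 2))"
proof -
  \<comment> \<open>\<open>j\<close> is the amount by which \<open>d\<close> falls short of the
    largest possible dimension, and \<open>n - 2 * m\<close> is the parity of
    \<open>n\<close>.\<close>
  define m j where "m = n div 2" and "j = m - d"
  have j: "m = d + j" and k: "k \<le> 2 * j + (n - 2 * m)"
    using assms(2) unfolding m_def j_def by linarith+
  have "q ^ d + 2 * j \<le> q ^ m"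
  proof (cases "q = 2 \<and> d = 0")
    case True
    then show ?thesis
      using assms(1) double_less_power_2[of m] j by (simp add: m_def)
  next
    case False
    then show ?thesis
      using assms(1) unfolding j by (intro power_plus_double_le) auto
  qed
  then show ?thesis
    using k unfolding m_def by linarith
qed

lemma omega_eqI:
  fixes U :: "'a::{field,finite} set"
  assumes "\<forall>x\<in>C. \<forall>y\<in>C. x \<noteq> y \<longrightarrow> x * y \<in> U" "card C = m"
    and "\<And>D. \<forall>x\<in>D. \<forall>y\<in>D. x \<noteq> y \<longrightarrow> x * y \<in> U \<Longrightarrow> card D \<le> m"
  shows "omega_G U = m"
proof -
  have edge: "{x, y} \<in> product_graph_edges U \<longleftrightarrow> x \<noteq> y \<and> x * y \<in> U" for x y
    by (auto simp: product_graph_edges_def doubleton_eq_iff mult.commute)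
  have clique: "clique D (product_graph_edges U) \<longleftrightarrow> (\<forall>x\<in>D. \<forall>y\<in>D. x \<noteq> y \<longrightarrow> x * y \<in> U)" for D
    by (auto simp: clique_def edge)
  show ?thesis
    unfolding clique_number_def clique
  proof (rule Max_eqI)
    show "finite {card D |D. D \<subseteq> UNIV \<and> (\<forall>x\<in>D. \<forall>y\<in>D. x \<noteq> y \<longrightarrow> x * y \<in> U)}"
      by simp
  qed (use assms in auto)
qed

context finite_field_extension
begin

lemma omega_hyperplane_eqI:
  assumes c: "c \<noteq> 0"
    and "finite_symmetric_form.orthogonal_family (\<lambda>x y. tr (c * (x * y))) C" "card C = m"
    and "\<And>D. finite_symmetric_form.orthogonal_family (\<lambda>x y. tr (c * (x * y))) D \<Longrightarrow> card D \<le> m"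
  shows "omega_G (hyperplane c) = m"
proof -
  interpret F: finite_symmetric_form "ext_scale \<iota>" "\<lambda>x y. tr (c * (x * y))"
    by (rule finite_symmetric_form_tr[OF c])
  show ?thesis
    using assms(2-) by (intro omega_eqI[of C]) (auto simp: F.orthogonal_family_def)
qed

lemma two_eq_0_iff: "(2::'k) = 0 \<longleftrightarrow> even q"
  using two_eq_0_iff_even_card[where 'a = 'k] primepow_q by simp

lemma omega_even_q_or_odd_n:
  assumes c: "c \<noteq> 0" and qn: "q > 2 \<or> n \<ge> 6" and "even q \<or> odd n"
  shows "omega_G (hyperplane c) = q ^ (n div 2) + (n - 2 * (n div 2))"
proof -
  interpret F: finite_symmetric_form "ext_scale \<iota>" "\<lambda>x y. tr (c * (x * y))"
    by (rule finite_symmetric_form_tr[OF c])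
  obtain W C d where WCd: "2 * d \<le> n" "n \<le> 2 * d + 2" "(2::'k) = 0 \<Longrightarrow> n \<le> 2 * d + 1"
    "F.orthogonal_family C" "card C = q ^ d + (n - 2 * d)"
    using F.orthogonal_family_dim_exists[of n, unfolded card_base, OF card_ext] by blast
  \<comment> \<open>For even \<open>q\<close> this is the bound in characteristic 2; for odd
    \<open>n\<close> parity improves \<open>n \<le> 2 * d + 2\<close>.\<close>
  have "n \<le> 2 * d + 1"
    using assms(3) WCd(2,3) two_eq_0_iff by (cases "even q") (auto elim!: oddE)
  then have "d = n div 2"
    using WCd(1) by linarith
  show ?thesis
  proof (rule omega_hyperplane_eqI[OF c WCd(4)])
    show "card C = q ^ (n div 2) + (n - 2 * (n div 2))"
      using WCd(5) \<open>d = n div 2\<close> by simp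
    fix D assume "F.orthogonal_family D"
    then obtain W d k where "2 * d + k \<le> n" "card D \<le> q ^ d + k"
      using F.orthogonal_family_dim_le[of n D, unfolded card_base, OF card_ext] by blast
    moreover have "q > 2 \<or> q = 2 \<and> n \<ge> 6"
      using qn q_gt_1 by linarith
    ultimately show "card D \<le> q ^ (n div 2) + (n - 2 * (n div 2))"
      using clique_size_bound order.trans by blast
  qed
qed

text \<open>In these small dimensions an orthogonal basis together with 0 already attains the bound
  \<open>2 ^ d + k\<close>, with \<open>d = 0\<close> and \<open>k = n\<close>.\<close>

lemma omega_q_2:
  assumes c: "c \<noteq> 0" and q: "q = 2" and n: "n \<le> 5"
  shows "omega_G (hyperplane c) = n + 1"
proof -
  interpret F: finite_symmetric_form "ext_scale \<iota>" "\<lambda>x y. tr (c * (x * y))"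
    by (rule finite_symmetric_form_tr[OF c])
  have two: "(2::'k) = 0"
    by (simp add: two_eq_0_iff q)
  have two': "(2::'a) = 0"
    using two emb_add[of 1 1] by simp
  obtain z where z: "tr z \<noteq> 0"
    using tr_nonzero by blast
  \<comment> \<open>Squaring is onto, so some \<open>v\<close> has \<open>c * v\<^sup>2 = z\<close>;
    hence the form is not alternating and has an orthogonal basis.\<close>
  obtain v where "v\<^sup>2 = z / c"
    using square_surj_char_2[OF two'] .
  then have "tr (c * (v * v)) \<noteq> 0"
    using z c by (simp add: power2_eq_square)
  then obtain C where C: "F.orthogonal_family C" "F.nonisotropic C" "q ^ card C = q ^ n"
    using F.orthogonal_basis_char_2[OF two] by (metis card_base card_ext)
  have "card C = n"
    using C(3) q by simp
  have "0 \<notin> C"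
    using C(2) F.zero_left[of 0] by (auto simp: F.nonisotropic_def)
  show ?thesis
  proof (rule omega_hyperplane_eqI[OF c])
    show "F.orthogonal_family (insert 0 C)"
      using C(1) F.zero_left F.zero_right by (auto simp: F.orthogonal_family_def)
    show "card (insert 0 C) = n + 1"
      using \<open>0 \<notin> C\<close> \<open>card C = n\<close> by simp
    fix D assume "F.orthogonal_family D"
    then obtain W d k where dk: "2 * d + k \<le> n" "card D \<le> q ^ d + k"
      using F.orthogonal_family_dim_le[of n D, unfolded card_base, OF card_ext] by blast
    then consider "d = 0" | "d = 1" | "d = 2"
      using n by linarith
    then show "card D \<le> n + 1"
      using dk q by cases auto
  qed
qed

text \<open>The condition asks for a totally isotropic space of half the dimension, put
  multiplicatively. For odd \<open>q\<close> such a form is a sum of hyperbolic planes.\<close>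

definition hyperbolic :: "'a \<Rightarrow> bool" where
  "hyperbolic c \<longleftrightarrow> (\<exists>W. finite_symmetric_form.totally_isotropic (ext_scale \<iota>)
     (\<lambda>x y. tr (c * (x * y))) W \<and> card W * card W = q ^ n)"

text \<open>In the hyperbolic case the half-dimensional space is an optimal clique. Otherwise
  totally isotropic spaces have dimension below \<open>m\<close>, and the codimension bound gives
  one of dimension \<open>m - 1\<close>, with room for two anisotropic vectors.\<close>

lemma omega_even_dim:
  assumes c: "c \<noteq> 0" and q: "odd q" and n: "n = 2 * m"
  shows "omega_G (hyperplane c) = (if hyperbolic c then q ^ m else q ^ (m - 1) + 2)"
proof -
  interpret F: finite_symmetric_form "ext_scale \<iota>" "\<lambda>x y. tr (c * (x * y))"
    by (rule finite_symmetric_form_tr[OF c])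
  have q3: "q \<ge> 3"
    using q q_gt_1 by (auto elim!: oddE)
  have qn: "q ^ n = q ^ m * q ^ m"
    by (simp add: n mult_2 power_add)
  have hyp: "hyperbolic c" if "F.totally_isotropic W" "card W = q ^ m" for W
    using that qn by (auto simp: hyperbolic_def)
  show ?thesis
  proof (cases "hyperbolic c")
    case True
    then obtain W where W: "F.totally_isotropic W" "card W * card W = q ^ n"
      by (auto simp: hyperbolic_def)
    have "(card W)\<^sup>2 = (q ^ m)\<^sup>2"
      using W(2) qn by (simp add: power2_eq_square)
    then have cW: "card W = q ^ m"
      by simp
    have "omega_G (hyperplane c) = q ^ m"
    proof (rule omega_hyperplane_eqI[OF c _ cW])
      show "F.orthogonal_family W"
        using W(1) by (auto simp: F.totally_isotropic_def F.orthogonal_family_def F.perp_def)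
      fix D assume "F.orthogonal_family D"
      then obtain W d k where "2 * d + k \<le> n" "card D \<le> q ^ d + k"
        using F.orthogonal_family_dim_le[of n D, unfolded card_base, OF card_ext] by blast
      then show "card D \<le> q ^ m"
        using clique_size_bound[of q n d k] q3 n by simp
    qed
    with True show ?thesis by simp
  next
    case False
    obtain W C d where WCd: "F.totally_isotropic W" "card W = q ^ d" "2 * d \<le> n" "n \<le> 2 * d + 2"
      "F.orthogonal_family C" "card C = q ^ d + (n - 2 * d)"
      using F.orthogonal_family_dim_exists[of n, unfolded card_base, OF card_ext] by blast
    have "d \<noteq> m"
      using hyp WCd False by blast
    then have d: "d = m - 1" "n - 2 * d = 2"
      using WCd(3,4) n by linarith+
    have "omega_G (hyperplane c) = q ^ (m - 1) + 2"
    proof (rule omega_hyperplane_eqI[OF c WCd(5)])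
      show "card C = q ^ (m - 1) + 2"
        using WCd(6)[unfolded d(2)] d(1) by simp
      fix D assume "F.orthogonal_family D"
      then obtain W d k where dk: "F.totally_isotropic W" "card W = q ^ d"
          "2 * d + k \<le> n" "card D \<le> q ^ d + k"
        using F.orthogonal_family_dim_le[of n D, unfolded card_base, OF card_ext] by blast
      have "d \<noteq> m"
        using hyp dk False by blast
      then obtain j where j: "m - 1 = d + j" "k \<le> 2 * j + 2"
        using dk(3) n by (intro that[of "m - 1 - d"]) linarith+
      have "q ^ d + 2 * j \<le> q ^ (m - 1)"
        unfolding j(1) using q3 by (intro power_plus_double_le) simp
      then show "card D \<le> q ^ (m - 1) + 2"
        using dk(4) j(2) by linarith
    qed
    with False show ?thesis by simp
  qed
qed

text \<open>If \<open>z ^ (q ^ m) = - z\<close>, the trace summands for \<open>i\<close> and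
  \<open>m + i\<close> cancel. All products \<open>y * (a * b)\<close> with \<open>a\<close>,
  \<open>b\<close> in the subfield of order \<open>q ^ m\<close> are such \<open>z\<close>.\<close>

lemma hyperbolicI:
  assumes n: "n = 2 * m" and q: "odd q" and c: "c \<noteq> 0"
    and y: "y ^ (q ^ m) = - y" and x: "c * x\<^sup>2 = y" "x \<noteq> 0"
  shows "hyperbolic c"
proof -
  interpret F: finite_symmetric_form "ext_scale \<iota>" "\<lambda>x y. tr (c * (x * y))"
    by (rule finite_symmetric_form_tr[OF c])
  define L where "L = {l::'a. l ^ (q ^ m) = l}"
  define W where "W = (\<lambda>l. x * l) ` L"
  have m: "m > 0"
    using n n_pos by simp
  have tr0: "tr z = 0" if z: "z ^ (q ^ m) = - z" for z
  proof -
    have "z ^ (q ^ (m + i)) = - (z ^ (q ^ i))" for i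
      using q by (simp add: power_add power_mult z)
    moreover have "(\<Sum>i<m + k. z ^ (q ^ i)) = (\<Sum>i<m. z ^ (q ^ i)) + (\<Sum>i<k. z ^ (q ^ (m + i)))" for k
      by (induction k) (simp_all add: add.assoc)
    ultimately have "field_trace q (m + m) z = 0"
      by (simp add: field_trace_def sum_negf)
    then have "field_trace q n z = 0"
      by (simp add: n mult_2)
    then show ?thesis
      by (simp only: tr_eq_0_iff)
  qed
  have L_0: "0 \<in> L"
    using q_gt_1 by (simp add: L_def power_0_left)
  have L_add: "a + b \<in> L" if "a \<in> L" "b \<in> L" for a b
    using that by (simp add: L_def frobenius_add)
  have L_mult: "a * b \<in> L" if "a \<in> L" "b \<in> L" for a b
    using that by (simp add: L_def power_mult_distrib)
  have L_emb: "\<iota> a \<in> L" for a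
    by (simp add: L_def emb_power_q)
  have "subspace W"
    unfolding subspace_def
  proof (intro conjI ballI allI)
    show "0 \<in> W"
      unfolding W_def using L_0 by (rule image_eqI[rotated]) simp
  next
    fix u v assume "u \<in> W" "v \<in> W"
    then obtain a b where "u = x * a" "v = x * b" "a \<in> L" "b \<in> L"
      by (auto simp: W_def)
    then show "u + v \<in> W"
      unfolding W_def by (intro image_eqI[of _ _ "a + b"]) (simp_all add: distrib_left L_add)
  next
    fix k u assume "u \<in> W"
    then obtain a where "u = x * a" "a \<in> L"
      by (auto simp: W_def)
    then show "ext_scale \<iota> k u \<in> W"
      unfolding W_def ext_scale_def
      by (intro image_eqI[of _ _ "\<iota> k * a"]) (simp_all add: L_mult L_emb)
  qed
  moreover have "W \<subseteq> F.perp W"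
  proof -
    have "tr (c * (x * a * (x * b))) = 0" if "a \<in> L" "b \<in> L" for a b
    proof -
      have "c * (x * a * (x * b)) = y * (a * b)"
        unfolding x(1)[symmetric] by (simp add: power2_eq_square)
      moreover have "(y * (a * b)) ^ (q ^ m) = - (y * (a * b))"
        using L_mult[OF that] by (simp add: power_mult_distrib[of y] y L_def)
      ultimately show ?thesis
        by (metis tr0)
    qed
    then show ?thesis
      by (auto simp: W_def F.perp_def)
  qed
  moreover have "card W = q ^ m"
  proof -
    have "card W = card L"
      unfolding W_def using x(2) by (intro card_image) (auto intro: inj_onI)
    also have "\<dots> = q ^ m"
      unfolding L_def using n m by (intro card_fixed_points) auto
    finally show ?thesis .
  qed
  moreover have "q ^ n = q ^ m * q ^ m"
    by (simp add: n mult_2 power_add)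
  ultimately show ?thesis
    unfolding hyperbolic_def F.totally_isotropic_def by metis
qed

text \<open>With \<open>d = q ^ m - 1\<close>, the order \<open>d * (d + 2)\<close> of the
  multiplicative group is divisible by \<open>2 * d\<close>. So some \<open>y\<close> has
  \<open>y ^ (2 * d) = 1\<close> but \<open>y ^ d \<noteq> 1\<close>.\<close>

lemma minus_fixed_point_exists:
  assumes n: "n = 2 * m" and q: "odd q"
  obtains y :: 'a where "y \<noteq> 0" "y ^ (q ^ m - 1) = - 1"
proof -
  define d where "d = q ^ m - 1"
  have m: "m > 0"
    using n n_pos by simp
  have qm: "q ^ m > 1"
    using q_gt_1 m by (simp only: one_less_power)
  then have d: "d > 0" "q ^ m = d + 1"
    by (simp_all add: d_def)
  have "even d"
    unfolding d_def using q by simp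
  have "CARD('a) - 1 = d * (d + 2)"
    by (simp add: card_ext n mult_2 power_add d(2))
  moreover have "2 dvd d + 2"
    using \<open>even d\<close> by simp
  ultimately have "d * 2 dvd CARD('a) - 1"
    by (simp only: mult_dvd_mono dvd_refl)
  then have "card {x::'a. x ^ (d * 2) = 1} = d * 2"
    by (rule card_roots_of_unity)
  moreover have "card {x::'a. x ^ d = 1} \<le> d"
    using card_roots_of_unity_le[OF d(1)] .
  ultimately have "\<not> {x::'a. x ^ (d * 2) = 1} \<subseteq> {x. x ^ d = 1}"
    using d(1) card_mono[of "{x::'a. x ^ d = 1}" "{x. x ^ (d * 2) = 1}"] by auto
  then obtain y :: 'a where "y ^ (d * 2) = 1" "y ^ d \<noteq> 1"
    by blast
  then have "y ^ d = - 1"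
    by (simp add: power_mult power2_eq_1_iff)
  moreover from this have "y \<noteq> 0"
    using d(1) by (auto simp: power_0_left)
  ultimately show ?thesis
    using that d_def by blast
qed

text \<open>For each \<open>z\<close> the equations \<open>x\<^sup>2 = z\<close> and
  \<open>\<nu> * x\<^sup>2 = z\<close> have two solutions between them: one each if
  \<open>z = 0\<close>, otherwise both from the first or both from the second as \<open>z\<close> is
  a square or not.\<close>

lemma card_zeros_add_card_zeros:
  assumes q: "odd q" and c: "c \<noteq> 0" and \<nu>: "\<nu> \<noteq> 0" "\<nexists>x. \<nu> = x\<^sup>2"
  shows "card {x. tr (c * x\<^sup>2) = 0} + card {x. tr (c * (\<nu> * x\<^sup>2)) = 0} = 2 * card (hyperplane c)"
proof -
  have odd: "odd CARD('a)"
    using q by (simp add: card_ext)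
  have two: "(2::'a) \<noteq> 0"
  proof -
    have "(2::'k) \<noteq> 0"
      using q by (simp add: two_eq_0_iff)
    moreover have "\<iota> 2 = 2"
      using emb_add[of 1 1] by simp
    ultimately show ?thesis
      by (metis emb_eq_0_iff)
  qed
  have roots: "card {x. x\<^sup>2 = z\<^sup>2} = 2" if "z \<noteq> 0" for z :: 'a
  proof -
    have "{x. x\<^sup>2 = z\<^sup>2} = {z, - z}"
      by (auto simp: power2_eq_iff)
    moreover have "z \<noteq> - z"
    proof
      assume "z = - z"
      then have "2 * z = 0"
        by (metis add.right_inverse mult_2)
      then show False
        using two that by simp
    qed
    ultimately show ?thesis
      by simp
  qed
  have fib: "card {x. x\<^sup>2 = z} + card {x. \<nu> * x\<^sup>2 = z} = 2" for z
  proof (cases "z = 0")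
    case True
    then show ?thesis
      using \<nu> by simp
  next
    case z: False
    show ?thesis
    proof (cases "\<exists>w. z = w\<^sup>2")
      case True
      then obtain w where w: "z = w\<^sup>2" by blast
      have "\<nu> * x\<^sup>2 \<noteq> z" for x
      proof
        assume "\<nu> * x\<^sup>2 = z"
        moreover from this have "x \<noteq> 0"
          using z by auto
        ultimately have "\<nu> = (w / x)\<^sup>2"
          by (simp add: w power_divide eq_divide_eq)
        then show False
          using \<nu>(2) by blast
      qed
      then show ?thesis
        using roots[of w] w z by simp
    next
      case False
      \<comment> \<open>Both \<open>z\<close> and \<nu> are nonsquares, so their powers are
        \<open>- 1\<close> and the quotient has power 1.\<close>
      have "(z / \<nu>) ^ ((CARD('a) - 1) div 2) = 1"
        using False \<nu> z Euler_criterion_finite_field[OF odd, of z] Euler_criterion_finite_field[OF odd, of \<nu>]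
          power_half_card_cases[OF odd, of z] power_half_card_cases[OF odd, of \<nu>]
        by (auto simp: power_divide)
      then obtain w where w: "z / \<nu> = w\<^sup>2"
        using Euler_criterion_finite_field[OF odd, of "z / \<nu>"] z \<nu> by auto
      then have "\<nu> * x\<^sup>2 = z \<longleftrightarrow> x\<^sup>2 = w\<^sup>2" for x
        using \<nu>(1) by (auto simp: field_simps)
      moreover have "w \<noteq> 0"
        using w z \<nu> by auto
      moreover have "{x. x\<^sup>2 = z} = {}"
        using False by blast
      ultimately show ?thesis
        using roots by simp
    qed
  qed
  have count: "card {x. tr (c * f x) = 0} = (\<Sum>z\<in>hyperplane c. card {x. f x = z})" for f :: "'a \<Rightarrow> 'a"
  proof -
    have "{x. tr (c * f x) = 0} = (\<Union>z\<in>hyperplane c. {x. f x = z})"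
      by auto
    then show ?thesis
      by (simp only:) (subst card_UN_disjoint; auto)
  qed
  show ?thesis
    unfolding count[of "\<lambda>x. x\<^sup>2"] count[of "\<lambda>x. \<nu> * x\<^sup>2"] sum.distrib[symmetric] fib by simp
qed

text \<open>
  The squares and the nonsquares together cover the hyperplane evenly, so the two classes of
  forms have \<open>2 * q ^ (n - 1)\<close> isotropic vectors between them; a hyperbolic form
  has more than half of these.
\<close>
lemma not_hyperbolic_other_class:
  assumes q: "odd q" and c: "c \<noteq> 0" and \<nu>: "\<nu> \<noteq> 0" "\<nexists>x. \<nu> = x\<^sup>2"
    and hyp: "hyperbolic (c * \<nu>)"
  shows "\<not> hyperbolic c"
proof
  assume "hyperbolic c"
  have gt: "q * card {x. tr (d * x\<^sup>2) = 0} > q ^ n" if "d \<noteq> 0" "hyperbolic d" for d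
  proof -
    interpret F: finite_symmetric_form "ext_scale \<iota>" "\<lambda>x y. tr (d * (x * y))"
      by (rule finite_symmetric_form_tr[OF that(1)])
    have "(2::'k) \<noteq> 0"
      using q by (simp add: two_eq_0_iff)
    then show ?thesis
      using that(2) F.card_isotropic_vectors_gt
      by (auto simp: hyperbolic_def card_ext power2_eq_square)
  qed
  have "q ^ n < q * card {x. tr (c * x\<^sup>2) = 0}" "q ^ n < q * card {x. tr (c * (\<nu> * x\<^sup>2)) = 0}"
    using gt[OF c \<open>hyperbolic c\<close>] gt[of "c * \<nu>"] hyp c \<nu> by (simp_all add: mult.assoc)
  then have "2 * q ^ n < q * (card {x. tr (c * x\<^sup>2) = 0} + card {x. tr (c * (\<nu> * x\<^sup>2)) = 0})"
    by (simp add: distrib_left)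
  also have "\<dots> = 2 * q ^ n"
    unfolding card_zeros_add_card_zeros[OF q c \<nu>] using card_hyperplane[OF c] by simp
  finally show False by simp
qed

text \<open>The form of \<open>y\<close> is hyperbolic, so that of \<open>c\<close> is so exactly
  when \<open>c\<close> and \<open>y\<close> share a square class. Whether \<open>y\<close> is a
  square depends only on \<open>q ^ m\<close> modulo 4.\<close>

lemma hyperbolic_iff:
  assumes n: "n = 2 * m" and q: "odd q" and c: "c \<noteq> 0"
  shows "hyperbolic c \<longleftrightarrow> ((\<exists>x. c = x\<^sup>2) \<longleftrightarrow> q ^ m mod 4 = 3)"
proof -
  let ?h = "(CARD('a) - 1) div 2"
  have odd: "odd CARD('a)"
    using q by (simp add: card_ext)
  obtain y :: 'a where y: "y \<noteq> 0" "y ^ (q ^ m - 1) = - 1"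
    using minus_fixed_point_exists[OF n q] .
  have "q ^ m > 0"
    using q_gt_1 by simp
  then have "y ^ (q ^ m) = y * y ^ (q ^ m - 1)"
    by (metis Suc_pred' power_Suc)
  then have y': "y ^ (q ^ m) = - y"
    using y(2) by simp
  have one: "(1::'a) \<noteq> - 1"
  proof
    assume "(1::'a) = - 1"
    then have "\<iota> (1 + 1) = 0"
      unfolding emb_add emb_1 by (metis add.right_inverse)
    then show False
      using q two_eq_0_iff by simp
  qed
  have "hyperbolic c \<longleftrightarrow> (\<exists>x. y / c = x\<^sup>2)"
  proof
    assume "hyperbolic c"
    show "\<exists>x. y / c = x\<^sup>2"
    proof (rule ccontr)
      assume "\<nexists>x. y / c = x\<^sup>2"
      moreover have "hyperbolic (c * (y / c))"
        using hyperbolicI[OF n q _ y', of y 1] y(1) c by simp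
      ultimately show False
        using not_hyperbolic_other_class[OF q c, of "y / c"] y(1) c \<open>hyperbolic c\<close> by simp
    qed
  next
    assume "\<exists>x. y / c = x\<^sup>2"
    then obtain x where "y / c = x\<^sup>2" by blast
    then have "c * x\<^sup>2 = y" "x \<noteq> 0"
      using y(1) c by (auto simp: divide_eq_eq)
    then show "hyperbolic c"
      using hyperbolicI[OF n q c y'] by blast
  qed
  also have "\<dots> \<longleftrightarrow> y ^ ?h / c ^ ?h = 1"
    using Euler_criterion_finite_field[OF odd, of "y / c"] y(1) c by (simp add: power_divide)
  also have "\<dots> \<longleftrightarrow> (c ^ ?h = 1 \<longleftrightarrow> y ^ ?h = 1)"
    using power_half_card_cases[OF odd y(1)] power_half_card_cases[OF odd c] one c by auto
  also have "y ^ ?h = (- 1) ^ ((q ^ m + 1) div 2)"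
  proof -
    obtain e where e: "q ^ m = 2 * e + 1"
      using q by (metis even_power oddE)
    have "q ^ n = q ^ m * q ^ m"
      by (simp add: n mult_2 power_add)
    then have "CARD('a) - 1 = 2 * (2 * e * (e + 1))"
      by (simp add: card_ext e algebra_simps)
    \<comment> \<open>This factorisation brings in the known value of
      \<open>y ^ (q ^ m - 1)\<close>.\<close>
    then have "?h = (q ^ m - 1) * ((q ^ m + 1) div 2)"
      by (simp add: e)
    then show ?thesis
      by (simp only: power_mult y(2))
  qed
  also have "(- 1 :: 'a) ^ ((q ^ m + 1) div 2) = 1 \<longleftrightarrow> even ((q ^ m + 1) div 2)"
    using one by (metis neg_one_even_power neg_one_odd_power)
  also have "\<dots> \<longleftrightarrow> q ^ m mod 4 = 3"
  proof -
    have "odd (q ^ m)"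
      using q by simp
    then show ?thesis
      by presburger
  qed
  also have "c ^ ?h = 1 \<longleftrightarrow> (\<exists>x. c = x\<^sup>2)"
    using Euler_criterion_finite_field[OF odd c] by simp
  finally show ?thesis .
qed

text \<open>A hyperplane fixes \<open>c\<close> only up to a factor from the base field; for even
  \<open>n\<close> all such factors are squares in the extension, so the square class of
  \<open>c\<close> is well defined.\<close>

lemma sgn_hyperplane:
  assumes n: "even n" and q: "odd q" and c: "c \<noteq> 0"
  shows "sgn_subspace q n (hyperplane c) = (if \<exists>x. c = x\<^sup>2 then 1 else - 1)"
proof -
  have "(\<exists>a. a \<noteq> 0 \<and> hyperplane c = (\<lambda>u. a\<^sup>2 * u) ` trace_zero q n) \<longleftrightarrow> (\<exists>x. c = x\<^sup>2)"
  proof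
    assume "\<exists>x. c = x\<^sup>2"
    then obtain x where x: "c = x\<^sup>2" by blast
    then have "hyperplane c = (\<lambda>u. (inverse x)\<^sup>2 * u) ` trace_zero q n"
      using c by (subst hyperplane_scale) (auto simp: power_inverse)
    then show "\<exists>a. a \<noteq> 0 \<and> hyperplane c = (\<lambda>u. a\<^sup>2 * u) ` trace_zero q n"
      using x c by (intro exI[of _ "inverse x"]) auto
  next
    assume "\<exists>a. a \<noteq> 0 \<and> hyperplane c = (\<lambda>u. a\<^sup>2 * u) ` trace_zero q n"
    then obtain a where a: "a \<noteq> 0" "hyperplane c = hyperplane (inverse (a\<^sup>2))"
      using hyperplane_scale by (metis power_not_zero)
    obtain b where b: "c = \<iota> b * inverse (a\<^sup>2)"
      using hyperplane_eqD[OF _ c a(2)[symmetric]] a(1) by auto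
    then have "b \<noteq> 0"
      using c by auto
    have odd: "odd CARD('a)"
      using q by (simp add: card_ext)
    obtain m where m: "n = 2 * m"
      using n by blast
    have "\<iota> b ^ ((CARD('a) - 1) div 2) = 1"
    proof -
      obtain e where e: "q = 2 * e + 1"
        using q by (rule oddE)
      \<comment> \<open>As \<open>n\<close> is even, \<open>q\<^sup>2 - 1\<close> divides
        \<open>q ^ n - 1\<close>; as \<open>q + 1\<close> is even too, half of
        \<open>q ^ n - 1\<close> is still a multiple of \<open>q - 1\<close>.\<close>
      have "[(q\<^sup>2) ^ m = 1 ^ m] (mod (q\<^sup>2 - 1))"
        using q_gt_1 by (intro cong_pow) (simp add: cong_altdef_nat)
      then have "q\<^sup>2 - 1 dvd CARD('a) - 1"
        using q_gt_1 by (simp add: card_ext m power_mult cong_altdef_nat)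
      moreover have "q\<^sup>2 - 1 = 2 * ((q - 1) * (e + 1))"
        by (simp add: e power2_eq_square algebra_simps)
      ultimately obtain l where "CARD('a) - 1 = 2 * ((q - 1) * (e + 1)) * l"
        by (metis dvdE)
      then have "CARD('a) - 1 = 2 * ((q - 1) * ((e + 1) * l))"
        by (simp only: mult.assoc)
      then have "(CARD('a) - 1) div 2 = (q - 1) * ((e + 1) * l)"
        by (metis nonzero_mult_div_cancel_left zero_neq_numeral)
      moreover have "\<iota> b ^ (q - 1) = 1"
        using power_card_minus_1[OF \<open>b \<noteq> 0\<close>] by (metis card_base emb_1 emb_power)
      ultimately show ?thesis
        by (simp only: power_mult power_one)
    qed
    then obtain z where "\<iota> b = z\<^sup>2"
      using Euler_criterion_finite_field[OF odd, of "\<iota> b"] \<open>b \<noteq> 0\<close> by auto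
    then have "c = (z * inverse a)\<^sup>2"
      by (simp add: b power_mult_distrib power_inverse)
    then show "\<exists>x. c = x\<^sup>2" by blast
  qed
  then show ?thesis
    by (simp add: sgn_subspace_def)
qed

end

section \<open>Residues modulo 4 and the final case distinction\<close>

lemma odd_power_mod_4:
  assumes "odd (q::nat)"
  shows "q ^ m mod 4 = 3 \<longleftrightarrow> q mod 4 = 3 \<and> odd m"
proof -
  have "q mod 4 = 1 \<or> q mod 4 = 3"
    using assms by presburger
  moreover have "q ^ m mod 4 = (if q mod 4 = 3 \<and> odd m then 3 else 1)" if "q mod 4 = 1 \<or> q mod 4 = 3"
  proof (induction m)
    case (Suc m)
    have "q ^ Suc m mod 4 = (q mod 4) * (q ^ m mod 4) mod 4"
      by (simp add: mod_mult_eq)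
    then show ?case
      using that Suc.IH by auto
  qed simp
  ultimately show ?thesis
    by simp
qed

theorem theorem5p5:
  fixes q n :: nat
    and \<iota> :: "'k::{field,finite} \<Rightarrow> 'a::{field,finite}"
    and U :: "'a set"
  assumes "primepow q"
    and "n \<ge> 2"
    and "CARD('k) = q"
    and "CARD('a) = q ^ n"
    and "field_embedding \<iota>"
    and "U \<subset> UNIV"
    and "module.subspace (ext_scale \<iota>) U"
    and "vector_space.dim (ext_scale \<iota>) U = n - 1"
  shows "(q > 2 \<or> n \<ge> 6 \<longrightarrow>
            (even q \<or> odd n \<longrightarrow>
               omega_G U = q ^ (n div 2) + (n - 2 * (n div 2))) \<and>
            (odd q \<and> even n \<longrightarrow>
               ((q mod 4, n mod 4, sgn_subspace q n U)
                   \<in> {(1, 0, - 1), (3, 0, - 1), (3, 2, 1), (1, 2, - 1)} \<longrightarrow>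
                 omega_G U = q ^ (n div 2)) \<and>
               ((q mod 4, n mod 4, sgn_subspace q n U)
                   \<in> {(1, 0, 1), (3, 0, 1), (3, 2, - 1), (1, 2, 1)} \<longrightarrow>
                 omega_G U = q ^ (n div 2 - 1) + 2))) \<and>
         (q = 2 \<and> n \<le> 5 \<longrightarrow> omega_G U = n + 1)"
proof -
  interpret E: finite_field_extension \<iota> q n
    using assms by unfold_locales auto
  have "card U = q ^ (n - 1)"
    using E.card_subspace[OF assms(7)] assms(3,8) by simp
  then obtain c where c: "c \<noteq> 0" and U: "U = E.hyperplane c"
    using E.subspace_eq_hyperplane[OF assms(7)] by blast
  \<comment> \<open>One equivalence covers all eight triples: the form is hyperbolic exactly when
    the sign being 1 agrees with \<open>q mod 4 = 3 \<and> n mod 4 = 2\<close>.\<close>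
  have even_dim: "omega_G U = (if (sgn_subspace q n U = 1) = (q mod 4 = 3 \<and> n mod 4 = 2)
      then q ^ (n div 2) else q ^ (n div 2 - 1) + 2)"
    if "odd q" "even n"
  proof -
    have n: "n = 2 * (n div 2)"
      using that(2) by simp
    have "odd (n div 2) \<longleftrightarrow> n mod 4 = 2"
      using that(2) by presburger
    then have "E.hyperbolic c \<longleftrightarrow> ((\<exists>x. c = x\<^sup>2) \<longleftrightarrow> q mod 4 = 3 \<and> n mod 4 = 2)"
      using E.hyperbolic_iff[OF n that(1) c] odd_power_mod_4[OF that(1)] by simp
    moreover have "(\<exists>x. c = x\<^sup>2) \<longleftrightarrow> sgn_subspace q n U = 1"
      using E.sgn_hyperplane[OF that(2,1) c] unfolding U by simp
    ultimately show ?thesis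
      using E.omega_even_dim[OF c that(1) n] unfolding U by simp
  qed
  show ?thesis
    using E.omega_even_q_or_odd_n[OF c] E.omega_q_2[OF c] even_dim unfolding U[symmetric] by auto
qed

end
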